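(* Let $\beta\in(0,\beta_c)$ and $\gamma=(\beta_c/\beta)^2$. There exist constants $c>0$ and $C>0$ such that for all $x\ge 0$, $$\mathbb{P}(Z_\beta<-x)\ \ge\ C\,e^{-c x^{\gamma}}.$$
   Context: Let $\mathbb T=\bigcup_{n\ge 0}\{0,1\}^n$ be the binary tree, with $\{0,1\}^0=\{\varnothing\}$. For $u\in\mathbb T$, $|u|$ is the length of $u$, and $v\le u$ means that $v$ is an ancestor (prefix) of $u$ (possibly $u$ itself). Let $(G_v)_{v\in\mathbb T}$ be i.i.d. standard Gaussian random variables and let $X_u=\sum_{\varnothing<v\le u}G_v$ (so $X_\varnothing=0$). Set $\beta_c=\sqrt{2\log 2}$. For $\beta\in[0,\beta_c)$ define the derivative martingale (with respect to $\mathcal F_n=\sigma(X_u,|u|\le n)$) $$Z_n(\beta)=\frac1{2^n}\sum_{|u|=n}e^{\beta X_u-\frac{\beta^2}{2}n}(X_u-\beta n).$$ It converges almost surely to a limit denoted $Z_\beta$. *)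

theory Defs
  imports "HOL-Probability.Probability" "HOL-Library.Sublist"
begin

text \<open>
  The binary tree is the type \<^typ>\<open>bool list\<close>: vertices are finite binary words, the root is
  \<^term>\<open>[]\<close>, the ancestor order is \<^const>\<open>prefix\<close>. The family \<open>G\<close> of edge weights is indexed by
  all vertices; the weight of the root is never used.
\<close>

definition brw :: "(bool list \<Rightarrow> 'a \<Rightarrow> real) \<Rightarrow> bool list \<Rightarrow> 'a \<Rightarrow> real" where
  "brw G u \<omega> = (\<Sum>v | strict_prefix [] v \<and> prefix v u. G v \<omega>)"

definition beta_c :: real where
  "beta_c = sqrt (2 * ln 2)"

definition deriv_mart :: "(bool list \<Rightarrow> 'a \<Rightarrow> real) \<Rightarrow> real \<Rightarrow> nat \<Rightarrow> 'a \<Rightarrow> real" where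
  "deriv_mart G \<beta> n \<omega> =
     1 / 2 ^ n * (\<Sum>u | length u = n.
        exp (\<beta> * brw G u \<omega> - \<beta>\<^sup>2 / 2 * real n) * (brw G u \<omega> - \<beta> * real n))"

text \<open>
  For \<open>0 \<le> \<beta> < beta_c\<close> the sequence converges almost surely, so the arbitrary value that
  \<^const>\<open>lim\<close> takes where it diverges matters only on a null set.
\<close>

definition deriv_mart_limit :: "(bool list \<Rightarrow> 'a \<Rightarrow> real) \<Rightarrow> real \<Rightarrow> 'a \<Rightarrow> real" where
  "deriv_mart_limit G \<beta> \<omega> = lim (\<lambda>n. deriv_mart G \<beta> n \<omega>)"

end

theory Submission
  imports Defs
begin

text \<open>
  Write \<open>W\<close> for the limit of the additive martingale and \<open>Z\<close> for that of the derivative martingale.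
  Splitting the tree at generation \<open>N\<close> expresses \<open>Z\<close> as the average over the vertices \<open>u\<close> of that
  generation of \<open>exp (\<beta> X\<^sub>u - \<beta>\<^sup>2 N / 2) ((X\<^sub>u - \<beta> N) W\<^sub>u + Z\<^sub>u)\<close>, where the \<open>(W\<^sub>u, Z\<^sub>u)\<close> are independent
  copies of \<open>(W, Z)\<close>. Let \<open>\<delta>\<^sub>k\<close> be \<open>1/2\<close> to the power \<open>N - k\<close>. Forcing each weight of generation
  \<open>k \<le> N\<close> into \<open>[\<beta> - 2 \<delta>\<^sub>k, \<beta> - \<delta>\<^sub>k]\<close> puts \<open>X\<^sub>u - \<beta> N\<close> into \<open>[-4, -1]\<close>, and since there are \<open>2\<^sup>k\<close>
  such weights this costs only \<open>exp (- O(2\<^sup>N))\<close>. As \<open>Z - W\<close> has mean \<open>-1\<close>, asking for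
  \<open>Z\<^sub>u - W\<^sub>u < - 1/2\<close> at all \<open>u\<close> costs another factor \<open>p\<close> to the power \<open>2\<^sup>N\<close>, with \<open>p > 0\<close>. On this event
  \<open>Z \<le> - exp (\<beta>\<^sup>2 N / 2 - 4 \<beta>) / 2\<close>, and \<open>2\<^sup>N\<close> is \<open>exp (\<beta>\<^sup>2 N / 2)\<close> to the power \<open>\<gamma>\<close>.
\<close>

section \<open>Branching random walks along the binary tree\<close>

text \<open>The non-root ancestors of \<open>u\<close> are its initial segments of lengths 1 to
  \<open>length u\<close>. In the indexed form, concatenation and bounds generation by generation
  become index arithmetic.\<close>

lemma brw_eq_sum_take: "brw G u \<omega> = (\<Sum>i<length u. G (take (Suc i) u) \<omega>)"
proof -
  have "{v. strict_prefix [] v \<and> prefix v u} = (\<lambda>i. take (Suc i) u) ` {..<length u}"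
  proof (intro equalityI subsetI)
    fix v assume "v \<in> {v. strict_prefix [] v \<and> prefix v u}"
    then obtain w where u: "u = v @ w" and "v \<noteq> []"
      by (auto simp: strict_prefix_def prefix_def)
    then have "v = take (Suc (length v - 1)) u" "length v - 1 < length u"
      by (cases v; simp)+
    then show "v \<in> (\<lambda>i. take (Suc i) u) ` {..<length u}"
      by blast
  qed (auto simp: strict_prefix_def take_is_prefix)
  moreover have "inj_on (\<lambda>i. take (Suc i) u) {..<length u}"
    by (rule inj_onI) (metis Suc_inject Suc_leI length_take lessThan_iff min.absorb2)
  ultimately show ?thesis
    by (simp add: brw_def sum.reindex)
qed

lemma brw_append: "brw G (u @ w) \<omega> = brw G u \<omega> + brw (\<lambda>v. G (u @ v)) w \<omega>"
proof -
  have "(\<Sum>i<m + n. f i) = (\<Sum>i<m. f i) + (\<Sum>i<n. f (m + i))" for m n and f :: "nat \<Rightarrow> real"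
    by (induction n) simp_all
  then show ?thesis
    by (simp add: brw_eq_sum_take)
qed

lemma brw_Nil: "brw G [] \<omega> = 0"
  by (simp add: brw_eq_sum_take)

lemma brw_snoc: "brw G (u @ [b]) \<omega> = brw G u \<omega> + G (u @ [b]) \<omega>"
  by (simp add: brw_append[of G u] brw_eq_sum_take[of _ "[b]"])

lemma brw_cong:
  assumes "\<And>v. v \<noteq> [] \<Longrightarrow> prefix v u \<Longrightarrow> G v \<omega> = H v \<xi>"
  shows "brw G u \<omega> = brw H u \<xi>"
  unfolding brw_def by (intro sum.cong) (auto intro!: assms)

lemma finite_strict_prefixes: "finite {v. strict_prefix [] v \<and> prefix v u}"
  by (rule finite_subset[of _ "set (prefixes u)"]) auto

lemma card_nonempty_prefixes: "card {v. strict_prefix [] v \<and> prefix v (u :: bool list)} = length u"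
  \<comment> \<open>In the environment that is constantly 1 the walk counts its own steps.\<close>
  using brw_eq_sum_take[of "\<lambda>_ _. 1" u undefined] by (simp add: brw_def)

lemma finite_words: "finite {u :: bool list. length u = n}"
  using finite_lists_length_eq[of "UNIV :: bool set" n] by simp

lemma finite_words_le: "finite {u :: bool list. length u \<le> n}"
  using finite_lists_length_le[of "UNIV :: bool set" n] by simp

lemma card_words: "card {u :: bool list. length u = n} = 2 ^ n"
  using card_lists_length_eq[of "UNIV :: bool set" n] by simp

lemma sum_words_add:
  fixes f :: "bool list \<Rightarrow> real"
  shows "(\<Sum>u | length u = m + n. f u) = (\<Sum>u | length u = m. \<Sum>w | length w = n. f (u @ w))"
proof -
  have "bij_betw (\<lambda>(u, w). u @ w)
      ({u. length u = m} \<times> {w :: bool list. length w = n}) {u. length u = m + n}"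
    by (rule bij_betwI[where g = "\<lambda>u. (take m u, drop m u)"]) auto
  then have "(\<Sum>u | length u = m + n. f u) =
      (\<Sum>(u, w) \<in> {u. length u = m} \<times> {w. length w = n}. f (u @ w))"
    by (subst sum.reindex_bij_betw[symmetric]) (auto simp: case_prod_unfold)
  then show ?thesis
    by (simp add: sum.cartesian_product)
qed

lemma sum_words_Suc:
  fixes f :: "bool list \<Rightarrow> real"
  shows "(\<Sum>v | length v = Suc n. f v) = (\<Sum>u | length u = n. f (u @ [True]) + f (u @ [False]))"
proof -
  have "{w :: bool list. length w = 1} = {[True], [False]}"
    by (auto simp: length_Suc_conv)
  then show ?thesis
    using sum_words_add[of f n 1] by simp
qed

text \<open>
  The choices \<open>(p, s) = (1, 0)\<close> and \<open>(0, 1)\<close> give the derivative martingale and the additive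
  martingale.
\<close>

definition tilted_sum ::
  "(bool list \<Rightarrow> 'a \<Rightarrow> real) \<Rightarrow> real \<Rightarrow> real \<Rightarrow> real \<Rightarrow> nat \<Rightarrow> 'a \<Rightarrow> real" where
  "tilted_sum G \<beta> p s n \<omega> = 1 / 2 ^ n * (\<Sum>u | length u = n.
     exp (\<beta> * brw G u \<omega> - \<beta>\<^sup>2 / 2 * real n) * (p * (brw G u \<omega> - \<beta> * real n) + s))"

lemma deriv_mart_eq_tilted_sum: "deriv_mart G \<beta> n \<omega> = tilted_sum G \<beta> 1 0 n \<omega>"
  by (simp add: deriv_mart_def tilted_sum_def)

lemma tilted_sum_0: "tilted_sum G \<beta> p s 0 \<omega> = s"
  by (simp add: tilted_sum_def brw_Nil)

text \<open>The root weight never enters the walk. Later this makes the tree strictly below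
  \<open>u\<close> independent of the weight at \<open>u\<close>.\<close>

lemma tilted_sum_cong:
  assumes "\<And>v. v \<noteq> [] \<Longrightarrow> G v \<omega> = H v \<xi>"
  shows "tilted_sum G \<beta> p s n \<omega> = tilted_sum H \<beta> p s n \<xi>"
proof -
  have "brw G u \<omega> = brw H u \<xi>" for u
    by (rule brw_cong) (rule assms)
  then show ?thesis
    by (simp add: tilted_sum_def)
qed

text \<open>Along \<open>u @ w\<close> the exponential factors and the displacement is additive. The
  displacement of \<open>u\<close> therefore multiplies the additive martingale of the subtree at
  \<open>u\<close>, and the displacement within the subtree yields its derivative
  martingale.\<close>

lemma tilted_sum_add:
  "tilted_sum G \<beta> 1 0 (m + n) \<omega> = 1 / 2 ^ m * (\<Sum>u | length u = m.
     exp (\<beta> * brw G u \<omega> - \<beta>\<^sup>2 / 2 * real m) *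
     ((brw G u \<omega> - \<beta> * real m) * tilted_sum (\<lambda>v. G (u @ v)) \<beta> 0 1 n \<omega> +
       tilted_sum (\<lambda>v. G (u @ v)) \<beta> 1 0 n \<omega>))"
proof -
  define F where "F u = exp (\<beta> * brw G u \<omega> - \<beta>\<^sup>2 / 2 * real m)" for u
  define B where "B u w = brw (\<lambda>v. G (u @ v)) w \<omega>" for u w
  have "exp (\<beta> * brw G (u @ w) \<omega> - \<beta>\<^sup>2 / 2 * real (m + n)) =
      F u * exp (\<beta> * B u w - \<beta>\<^sup>2 / 2 * real n)" for u w
    unfolding F_def B_def brw_append[of G u w] exp_add[symmetric]
    by (simp add: algebra_simps)
  note E = this
  define A where "A u w = exp (\<beta> * B u w - \<beta>\<^sup>2 / 2 * real n)" for u w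
  define X where "X u = brw G u \<omega> - \<beta> * real m" for u
  have split: "exp (\<beta> * brw G (u @ w) \<omega> - \<beta>\<^sup>2 / 2 * real (m + n)) *
        (1 * (brw G (u @ w) \<omega> - \<beta> * real (m + n)) + 0) =
      F u * (X u * (A u w * (0 * (B u w - \<beta> * real n) + 1)) +
        A u w * (1 * (B u w - \<beta> * real n) + 0))" for u w
    unfolding E A_def[symmetric] by (simp add: brw_append[of G u w] B_def X_def algebra_simps)
  have inner: "1 / 2 ^ n * (\<Sum>w\<in>S. F u * (X u * f w + g w)) =
      F u * (X u * (1 / 2 ^ n * sum f S) + 1 / 2 ^ n * sum g S)" for u f g and S :: "bool list set"
    by (simp add: sum_distrib_left[symmetric] sum.distrib distrib_left)
  have outer: "1 / 2 ^ (m + n) * (\<Sum>u\<in>S. f u) = 1 / 2 ^ m * (\<Sum>u\<in>S. 1 / 2 ^ n * f u)"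
    for f :: "bool list \<Rightarrow> real" and S :: "bool list set"
    by (simp only: sum_distrib_left[symmetric]) (simp add: power_add)
  show ?thesis
    unfolding tilted_sum_def sum_words_add split outer inner
    by (simp only: F_def B_def A_def X_def)
qed

text \<open>With \<open>e = exp (\<beta> g - \<beta>\<^sup>2 / 2)\<close> and \<open>y\<close> the
  centred position of the parent, \<open>e (p (y + g - \<beta>) + s) - (p y + s)\<close> equals
  \<open>(p y + s) (e - 1) + p e (g - \<beta>)\<close>. Both \<open>e - 1\<close> and
  \<open>e (g - \<beta>)\<close> have mean zero and involve only the new weight. Writing
  \<open>0 * _ + p\<close> gives the second sum the shape of the first, with parameters
  \<open>(0, p)\<close>.\<close>

lemma tilted_sum_increment:
  "tilted_sum G \<beta> p s (Suc n) \<omega> - tilted_sum G \<beta> p s n \<omega> =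
    (\<Sum>v | length v = Suc n.
      1 / 2 ^ Suc n * exp (\<beta> * brw G (butlast v) \<omega> - \<beta>\<^sup>2 / 2 * real n) *
        (p * (brw G (butlast v) \<omega> - \<beta> * real n) + s) * (exp (\<beta> * G v \<omega> - \<beta>\<^sup>2 / 2) - 1)) +
    (\<Sum>v | length v = Suc n.
      1 / 2 ^ Suc n * exp (\<beta> * brw G (butlast v) \<omega> - \<beta>\<^sup>2 / 2 * real n) *
        (0 * (brw G (butlast v) \<omega> - \<beta> * real n) + p) * (exp (\<beta> * G v \<omega> - \<beta>\<^sup>2 / 2) * (G v \<omega> - \<beta>)))"
proof -
  define F where "F u = exp (\<beta> * brw G u \<omega> - \<beta>\<^sup>2 / 2 * real n)" for u
  define E where "E v = exp (\<beta> * G v \<omega> - \<beta>\<^sup>2 / 2)" for v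
  define X where "X u = brw G u \<omega>" for u
  have F: "exp (\<beta> * brw G (u @ [b]) \<omega> - \<beta>\<^sup>2 / 2 * real (Suc n)) = F u * E (u @ [b])" for u b
    unfolding F_def E_def by (simp add: brw_snoc exp_add[symmetric] algebra_simps)
  have step: "d * (F u * e1 * (p * (X u + g1 - \<beta> * real (Suc n)) + s) +
        F u * e2 * (p * (X u + g2 - \<beta> * real (Suc n)) + s)) -
      (d + d) * (F u * (p * (X u - \<beta> * real n) + s)) =
      (d * F u * (p * (X u - \<beta> * real n) + s) * (e1 - 1) +
       d * F u * (p * (X u - \<beta> * real n) + s) * (e2 - 1)) +
      (d * F u * (0 * (X u - \<beta> * real n) + p) * (e1 * (g1 - \<beta>)) +
       d * F u * (0 * (X u - \<beta> * real n) + p) * (e2 * (g2 - \<beta>)))"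
    for d e1 e2 g1 g2 u
    by (simp add: algebra_simps)
  \<comment> \<open>Each parent's term is shared equally between its two children.\<close>
  have half: "(1::real) / 2 ^ n = 1 / 2 ^ Suc n + 1 / 2 ^ Suc n"
    by simp
  show ?thesis
    unfolding tilted_sum_def sum_words_Suc sum_distrib_left sum_subtractf[symmetric]
      sum.distrib[symmetric] F
    unfolding butlast_snoc half brw_snoc
    unfolding F_def[symmetric] E_def[symmetric]
    unfolding X_def[symmetric]
    by (intro sum.cong refl) (rule step)
qed

section \<open>Gaussian moments and independence\<close>

text \<open>Completing the square: an exponential tilt by \<open>t\<close> moves the Gaussian mean
  to \<open>t\<close>.\<close>

lemma exp_mult_std_normal_density:
  "exp (t * x) * std_normal_density x = exp (t\<^sup>2 / 2) * normal_density t 1 x"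
  by (simp add: normal_density_def exp_add[symmetric] power2_diff power2_eq_square field_simps)

text \<open>A locale, so that all results can be reinterpreted for the environment of a
  subtree.\<close>

locale gaussian_tree = prob_space M for M :: "'a measure" +
  fixes G :: "bool list \<Rightarrow> 'a \<Rightarrow> real"
  assumes indep_G: "indep_vars (\<lambda>_. borel) G UNIV"
    and distributed_G: "\<And>v. distributed M lborel (G v) std_normal_density"
begin

lemma measurable_G [measurable]: "G v \<in> borel_measurable M"
  using distributed_measurable[OF distributed_G] by simp

lemma measurable_brw [measurable]: "brw G u \<in> borel_measurable M"
  unfolding brw_def by measurable

lemma measurable_tilted_sum [measurable]: "tilted_sum G \<beta> p s n \<in> borel_measurable M"
  unfolding tilted_sum_def by measurable

lemma
  assumes [measurable]: "h \<in> borel_measurable borel"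
  shows integrable_exp_mult_iff: "integrable M (\<lambda>\<omega>. exp (t * G v \<omega>) * h (G v \<omega>)) \<longleftrightarrow>
      integrable lborel (\<lambda>x. normal_density t 1 x * h x)"
    and expectation_exp_mult: "expectation (\<lambda>\<omega>. exp (t * G v \<omega>) * h (G v \<omega>)) =
      exp (t\<^sup>2 / 2) * (\<integral>x. normal_density t 1 x * h x \<partial>lborel)"
proof -
  have eq: "std_normal_density x * (exp (t * x) * h x) =
      exp (t\<^sup>2 / 2) * (normal_density t 1 x * h x)" for x
    unfolding mult.assoc[symmetric] exp_mult_std_normal_density[symmetric] by (simp add: mult_ac)
  show "integrable M (\<lambda>\<omega>. exp (t * G v \<omega>) * h (G v \<omega>)) \<longleftrightarrow>
      integrable lborel (\<lambda>x. normal_density t 1 x * h x)"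
    using distributed_integrable[OF distributed_G, of "\<lambda>x. exp (t * x) * h x" v]
    by (simp add: eq)
  show "expectation (\<lambda>\<omega>. exp (t * G v \<omega>) * h (G v \<omega>)) =
      exp (t\<^sup>2 / 2) * (\<integral>x. normal_density t 1 x * h x \<partial>lborel)"
    using distributed_integral[OF distributed_G, of "\<lambda>x. exp (t * x) * h x" v]
    by (simp add: eq)
qed

lemma integrable_exp_G: "integrable M (\<lambda>\<omega>. exp (t * G v \<omega>))"
  using integrable_exp_mult_iff[of "\<lambda>_. 1"] by simp

lemma expectation_exp_G: "expectation (\<lambda>\<omega>. exp (t * G v \<omega>)) = exp (t\<^sup>2 / 2)"
  using expectation_exp_mult[of "\<lambda>_. 1" t v] by simp

lemma
  shows integrable_exp_brw: "integrable M (\<lambda>\<omega>. exp (t * brw G u \<omega>))"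
    and expectation_exp_brw:
      "expectation (\<lambda>\<omega>. exp (t * brw G u \<omega>)) = exp (t\<^sup>2 / 2 * real (length u))"
proof -
  let ?I = "{v. strict_prefix [] v \<and> prefix v u}"
  have ind: "indep_vars (\<lambda>_. borel) (\<lambda>v \<omega>. exp (t * G v \<omega>)) ?I"
    by (rule indep_vars_compose2[of "\<lambda>_. borel" G])
       (auto intro: indep_vars_subset[OF indep_G])
  have eq: "exp (t * brw G u \<omega>) = (\<Prod>v\<in>?I. exp (t * G v \<omega>))" for \<omega>
    by (simp add: brw_def sum_distrib_left exp_sum[OF finite_strict_prefixes])
  show "integrable M (\<lambda>\<omega>. exp (t * brw G u \<omega>))"
    unfolding eq by (intro indep_vars_integrable finite_strict_prefixes ind integrable_exp_G)
  show "expectation (\<lambda>\<omega>. exp (t * brw G u \<omega>)) = exp (t\<^sup>2 / 2 * real (length u))"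
    unfolding eq indep_vars_lebesgue_integral[OF finite_strict_prefixes ind integrable_exp_G]
    by (simp add: expectation_exp_G card_nonempty_prefixes exp_of_nat2_mult[symmetric])
qed

lemma
  shows square_integrable_exp_tilt: "integrable M (\<lambda>\<omega>. (exp (\<beta> * G v \<omega> - \<beta>\<^sup>2 / 2) - 1)\<^sup>2)"
    and expectation_exp_tilt: "expectation (\<lambda>\<omega>. exp (\<beta> * G v \<omega> - \<beta>\<^sup>2 / 2) - 1) = 0"
proof -
  have "(exp (\<beta> * G v \<omega> - \<beta>\<^sup>2 / 2) - 1)\<^sup>2 =
      exp (- \<beta>\<^sup>2) * exp ((2 * \<beta>) * G v \<omega>) - 2 * exp (- \<beta>\<^sup>2 / 2) * exp (\<beta> * G v \<omega>) + 1" for \<omega>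
    by (simp add: power2_diff exp_double[symmetric] exp_add[symmetric] algebra_simps)
  then show "integrable M (\<lambda>\<omega>. (exp (\<beta> * G v \<omega> - \<beta>\<^sup>2 / 2) - 1)\<^sup>2)"
    by (simp add: integrable_exp_G)
  have eq: "exp (\<beta> * G v \<omega> - \<beta>\<^sup>2 / 2) - 1 = exp (- \<beta>\<^sup>2 / 2) * exp (\<beta> * G v \<omega>) - 1" for \<omega>
    by (simp add: exp_add[symmetric])
  have "expectation (\<lambda>\<omega>. exp (- \<beta>\<^sup>2 / 2) * exp (\<beta> * G v \<omega>) - 1) =
      exp (- \<beta>\<^sup>2 / 2) * expectation (\<lambda>\<omega>. exp (\<beta> * G v \<omega>)) - 1"
    by (subst Bochner_Integration.integral_diff)
       (auto simp only: integral_mult_right_zero prob_space integrable_exp_G integral_const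
         intro!: integrable_mult_right, simp_all add: prob_space)
  then show "expectation (\<lambda>\<omega>. exp (\<beta> * G v \<omega> - \<beta>\<^sup>2 / 2) - 1) = 0"
    unfolding eq by (simp add: expectation_exp_G exp_add[symmetric])
qed

lemma
  shows square_integrable_exp_tilt_deriv:
      "integrable M (\<lambda>\<omega>. (exp (\<beta> * G v \<omega> - \<beta>\<^sup>2 / 2) * (G v \<omega> - \<beta>))\<^sup>2)"
    and expectation_exp_tilt_deriv:
      "expectation (\<lambda>\<omega>. exp (\<beta> * G v \<omega> - \<beta>\<^sup>2 / 2) * (G v \<omega> - \<beta>)) = 0"
proof -
  have eq: "(exp (\<beta> * G v \<omega> - \<beta>\<^sup>2 / 2) * (G v \<omega> - \<beta>))\<^sup>2 =
      exp (- \<beta>\<^sup>2) * (exp ((2 * \<beta>) * G v \<omega>) * (G v \<omega> - \<beta>)\<^sup>2)" for \<omega>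
    unfolding power_mult_distrib mult.assoc[symmetric] exp_double[symmetric] exp_add[symmetric]
    by (simp add: algebra_simps)
  \<comment> \<open>Squaring doubles the tilt, so the polynomial is expanded around the new mean
    \<open>2 * \<beta>\<close>, where the centred moments are available.\<close>
  have "normal_density (2 * \<beta>) 1 x * (x - \<beta>)\<^sup>2 =
      normal_density (2 * \<beta>) 1 x * (x - 2 * \<beta>)\<^sup>2 +
      2 * \<beta> * (normal_density (2 * \<beta>) 1 x * (x - 2 * \<beta>) ^ 1) +
      \<beta>\<^sup>2 * (normal_density (2 * \<beta>) 1 x * (x - 2 * \<beta>) ^ 0)" for x
    by (simp add: power2_eq_square algebra_simps)
  moreover have "integrable lborel (\<lambda>x. normal_density (2 * \<beta>) 1 x * (x - 2 * \<beta>)\<^sup>2 +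
      2 * \<beta> * (normal_density (2 * \<beta>) 1 x * (x - 2 * \<beta>) ^ 1) +
      \<beta>\<^sup>2 * (normal_density (2 * \<beta>) 1 x * (x - 2 * \<beta>) ^ 0))"
    by (intro Bochner_Integration.integrable_add integrable_mult_right integrable_normal_moment) simp_all
  ultimately have "integrable lborel (\<lambda>x. normal_density (2 * \<beta>) 1 x * (x - \<beta>)\<^sup>2)"
    by simp
  then show "integrable M (\<lambda>\<omega>. (exp (\<beta> * G v \<omega> - \<beta>\<^sup>2 / 2) * (G v \<omega> - \<beta>))\<^sup>2)"
    unfolding eq by (intro integrable_mult_right)
      (simp add: integrable_exp_mult_iff[of "\<lambda>x. (x - \<beta>)\<^sup>2" "2 * \<beta>" v])
  have eq': "exp (\<beta> * G v \<omega> - \<beta>\<^sup>2 / 2) * (G v \<omega> - \<beta>) =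
      exp (- \<beta>\<^sup>2 / 2) * (exp (\<beta> * G v \<omega>) * (G v \<omega> - \<beta>))" for \<omega>
    by (simp add: exp_add[symmetric] mult.assoc[symmetric])
  have zero: "(\<integral>x. normal_density \<beta> 1 x * (x - \<beta>) \<partial>lborel) = 0"
    using integral_normal_moment_odd[of 1 \<beta> 0] by simp
  show "expectation (\<lambda>\<omega>. exp (\<beta> * G v \<omega> - \<beta>\<^sup>2 / 2) * (G v \<omega> - \<beta>)) = 0"
    unfolding eq' using expectation_exp_mult[of "\<lambda>x. x - \<beta>" \<beta> v] by (simp add: zero)
qed

lemma measurable_coordinate_brw:
  assumes "\<And>w. w \<noteq> [] \<Longrightarrow> prefix w u \<Longrightarrow> w \<in> K"
  shows "(\<lambda>x. brw (\<lambda>w x. x w) u x) \<in> borel_measurable (PiM K (\<lambda>_. borel :: real measure))"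
  unfolding brw_def using assms
  by (intro borel_measurable_sum measurable_component_singleton) auto

text \<open>Independence is obtained by exhibiting \<open>X\<close> as a function \<open>f\<close>
  of the family of weights with \<open>v\<close> removed.\<close>

lemma indep_var_fresh:
  assumes f: "f \<in> borel_measurable (PiM (UNIV - {v}) (\<lambda>_. borel))"
    and [measurable]: "g \<in> borel_measurable borel"
    and X: "\<And>\<omega>. X \<omega> = f (restrict (\<lambda>w. G w \<omega>) (UNIV - {v}))"
  shows "indep_var borel X borel (\<lambda>\<omega>. g (G v \<omega>))"
proof -
  have "indep_var (PiM (UNIV - {v}) (\<lambda>_. borel)) (\<lambda>\<omega>. restrict (\<lambda>w. G w \<omega>) (UNIV - {v}))
      (PiM {v} (\<lambda>_. borel)) (\<lambda>\<omega>. restrict (\<lambda>w. G w \<omega>) {v})"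
    by (rule indep_var_restrict[OF indep_G]) auto
  then have "indep_var borel (f \<circ> (\<lambda>\<omega>. restrict (\<lambda>w. G w \<omega>) (UNIV - {v})))
      borel ((\<lambda>x. g (x v)) \<circ> (\<lambda>\<omega>. restrict (\<lambda>w. G w \<omega>) {v}))"
    by (rule indep_var_compose) (use f in measurable)
  then show ?thesis
    by (simp add: comp_def X[symmetric])
qed

lemma
  fixes \<phi> g :: "real \<Rightarrow> real"
  assumes uv: "length u < length v"
    and [measurable]: "\<phi> \<in> borel_measurable borel" "g \<in> borel_measurable borel"
    and int: "integrable M (\<lambda>\<omega>. \<phi> (brw G u \<omega>))" "integrable M (\<lambda>\<omega>. g (G v \<omega>))"
  shows integrable_brw_mult: "integrable M (\<lambda>\<omega>. \<phi> (brw G u \<omega>) * g (G v \<omega>))"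
    and expectation_brw_mult: "expectation (\<lambda>\<omega>. \<phi> (brw G u \<omega>) * g (G v \<omega>)) =
      expectation (\<lambda>\<omega>. \<phi> (brw G u \<omega>)) * expectation (\<lambda>\<omega>. g (G v \<omega>))"
proof -
  have pre: "w \<noteq> v" if "prefix w u" for w
    using prefix_length_le[OF that] uv by auto
  have brw: "brw (\<lambda>w x. x w) u (restrict (\<lambda>w. G w \<omega>) (UNIV - {v})) = brw G u \<omega>" for \<omega>
    by (rule brw_cong) (simp add: pre)
  have "(\<lambda>x. \<phi> (brw (\<lambda>w x. x w) u x)) \<in> borel_measurable (PiM (UNIV - {v}) (\<lambda>_. borel))"
    by (rule measurable_compose[OF measurable_coordinate_brw]) (use pre in auto)
  then have ind: "indep_var borel (\<lambda>\<omega>. \<phi> (brw G u \<omega>)) borel (\<lambda>\<omega>. g (G v \<omega>))"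
    by (rule indep_var_fresh) (simp_all add: brw)
  show "integrable M (\<lambda>\<omega>. \<phi> (brw G u \<omega>) * g (G v \<omega>))"
    by (rule indep_var_integrable[OF ind int])
  show "expectation (\<lambda>\<omega>. \<phi> (brw G u \<omega>) * g (G v \<omega>)) =
      expectation (\<lambda>\<omega>. \<phi> (brw G u \<omega>)) * expectation (\<lambda>\<omega>. g (G v \<omega>))"
    by (rule indep_var_lebesgue_integral[OF ind int])
qed

text \<open>Intended for the parents \<open>u\<close>, \<open>u'\<close> of distinct vertices
  \<open>v\<close>, \<open>v'\<close> of one generation: \<open>v\<close> is an ancestor of neither
  parent and differs from \<open>v'\<close>, so its weight is independent of the remaining factors.
  This is the orthogonality of the increments.\<close>

lemma
  fixes \<phi> g :: "real \<Rightarrow> real"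
  assumes u: "length u < length v" "length u' < length v" and "v \<noteq> v'"
    and [measurable]: "\<phi> \<in> borel_measurable borel" "g \<in> borel_measurable borel"
    and bounded: "\<And>x. \<bar>\<phi> x\<bar> \<le> 1"
    and int: "\<And>w. integrable M (\<lambda>\<omega>. g (G w \<omega>))"
  shows integrable_cross: "integrable M (\<lambda>\<omega>. \<phi> (brw G u \<omega>) * \<phi> (brw G u' \<omega>) * g (G v' \<omega>) * g (G v \<omega>))"
    and expectation_cross: "expectation (\<lambda>\<omega>. \<phi> (brw G u \<omega>) * \<phi> (brw G u' \<omega>) * g (G v' \<omega>) * g (G v \<omega>)) =
      expectation (\<lambda>\<omega>. \<phi> (brw G u \<omega>) * \<phi> (brw G u' \<omega>) * g (G v' \<omega>)) * expectation (\<lambda>\<omega>. g (G v \<omega>))"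
proof -
  have pre: "w \<noteq> v" if "prefix w u \<or> prefix w u'" for w
    using prefix_length_le[of w u] prefix_length_le[of w u'] u that by auto
  have brw: "brw (\<lambda>w x. x w) u (restrict (\<lambda>w. G w \<omega>) (UNIV - {v})) = brw G u \<omega>"
    "brw (\<lambda>w x. x w) u' (restrict (\<lambda>w. G w \<omega>) (UNIV - {v})) = brw G u' \<omega>" for \<omega>
    by (rule brw_cong; simp add: pre)+
  have [measurable]:
    "(\<lambda>x. \<phi> (brw (\<lambda>w x. x w) u x)) \<in> borel_measurable (PiM (UNIV - {v}) (\<lambda>_. borel))"
    "(\<lambda>x. \<phi> (brw (\<lambda>w x. x w) u' x)) \<in> borel_measurable (PiM (UNIV - {v}) (\<lambda>_. borel))"
    "(\<lambda>x. g (x v')) \<in> borel_measurable (PiM (UNIV - {v}) (\<lambda>_. borel))"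
    by (rule measurable_compose[OF measurable_coordinate_brw]; use pre in auto)+
       (rule measurable_compose[OF measurable_component_singleton]; use \<open>v \<noteq> v'\<close> in auto)
  have "(\<lambda>x. \<phi> (brw (\<lambda>w x. x w) u x) * \<phi> (brw (\<lambda>w x. x w) u' x) * g (x v'))
      \<in> borel_measurable (PiM (UNIV - {v}) (\<lambda>_. borel))"
    by measurable
  then have ind: "indep_var borel (\<lambda>\<omega>. \<phi> (brw G u \<omega>) * \<phi> (brw G u' \<omega>) * g (G v' \<omega>))
      borel (\<lambda>\<omega>. g (G v \<omega>))"
    by (rule indep_var_fresh) (use \<open>v \<noteq> v'\<close> in \<open>simp_all add: brw\<close>)
  have bound: "\<bar>\<phi> x * \<phi> y\<bar> \<le> 1" for x y
    using mult_mono[OF bounded[of x] bounded[of y]] by (simp add: abs_mult)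
  have int': "integrable M (\<lambda>\<omega>. \<phi> (brw G u \<omega>) * \<phi> (brw G u' \<omega>) * g (G v' \<omega>))"
  proof (rule Bochner_Integration.integrable_bound[OF int[of v']])
    show "AE \<omega> in M. norm (\<phi> (brw G u \<omega>) * \<phi> (brw G u' \<omega>) * g (G v' \<omega>)) \<le> norm (g (G v' \<omega>))"
      using bound by (auto simp: abs_mult[of "_ * _"] mult_left_le_one_le)
  qed measurable
  show "integrable M (\<lambda>\<omega>. \<phi> (brw G u \<omega>) * \<phi> (brw G u' \<omega>) * g (G v' \<omega>) * g (G v \<omega>))"
    by (rule indep_var_integrable[OF ind int' int])
  show "expectation (\<lambda>\<omega>. \<phi> (brw G u \<omega>) * \<phi> (brw G u' \<omega>) * g (G v' \<omega>) * g (G v \<omega>)) =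
      expectation (\<lambda>\<omega>. \<phi> (brw G u \<omega>) * \<phi> (brw G u' \<omega>) * g (G v' \<omega>)) * expectation (\<lambda>\<omega>. g (G v \<omega>))"
    by (rule indep_var_lebesgue_integral[OF ind int' int])
qed

end

lemma (in prob_space) expectation_square_le:
  fixes f :: "'a \<Rightarrow> real"
  assumes "integrable M f" "integrable M (\<lambda>\<omega>. (f \<omega>)\<^sup>2)"
  shows "(expectation f)\<^sup>2 \<le> expectation (\<lambda>\<omega>. (f \<omega>)\<^sup>2)"
  using variance_positive[of f] variance_eq[OF assms] by simp

text \<open>By Tonelli the sum of the absolute values has finite integral, hence is finite almost
  everywhere.\<close>

lemma AE_summable_of_summable_integral:
  fixes f :: "nat \<Rightarrow> 'a \<Rightarrow> real"
  assumes int: "\<And>n. integrable M (f n)"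
    and sum: "summable (\<lambda>n. \<integral>x. \<bar>f n x\<bar> \<partial>M)"
  shows "AE x in M. summable (\<lambda>n. \<bar>f n x\<bar>)"
proof -
  have [measurable]: "f n \<in> borel_measurable M" for n
    using int by simp
  have "(\<integral>\<^sup>+x. (\<Sum>n. ennreal \<bar>f n x\<bar>) \<partial>M) = (\<Sum>n. \<integral>\<^sup>+x. ennreal \<bar>f n x\<bar> \<partial>M)"
    by (intro nn_integral_suminf) auto
  also have "\<dots> = (\<Sum>n. ennreal (\<integral>x. \<bar>f n x\<bar> \<partial>M))"
    by (intro arg_cong[where f = suminf] ext nn_integral_eq_integral integrable_abs int) auto
  also have "\<dots> < \<infinity>"
    by (simp add: sum ennreal_suminf_neq_top less_top[symmetric])
  finally have "(\<integral>\<^sup>+x. (\<Sum>n. ennreal \<bar>f n x\<bar>) \<partial>M) \<noteq> \<infinity>"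
    by simp
  then have "AE x in M. (\<Sum>n. ennreal \<bar>f n x\<bar>) \<noteq> \<infinity>"
    by (intro nn_integral_PInf_AE) auto
  then show ?thesis
    by eventually_elim (auto intro!: summable_suminf_not_top)
qed

section \<open>Convergence of the martingales\<close>

context gaussian_tree
begin

text \<open>
  The weights \<open>\<phi>\<close> are split at height \<open>1\<close>: orthogonality of the increments controls the small ones
  in \<open>L\<^sup>2\<close>, and the triangle inequality controls the large ones in \<open>L\<^sup>1\<close>. Both bounds follow
  from the same \<open>q\<close>-th moment with \<open>1 \<le> q \<le> 2\<close>.
\<close>

lemma
  fixes \<phi> g :: "real \<Rightarrow> real" and n :: nat
  defines "D \<equiv> \<lambda>\<omega>. \<Sum>v | length v = Suc n. \<phi> (brw G (butlast v) \<omega>) * g (G v \<omega>)"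
  assumes [measurable]: "\<phi> \<in> borel_measurable borel" "g \<in> borel_measurable borel"
    and g2: "\<And>v. integrable M (\<lambda>\<omega>. (g (G v \<omega>))\<^sup>2)"
    and g0: "\<And>v. expectation (\<lambda>\<omega>. g (G v \<omega>)) = 0"
    and \<sigma>: "0 \<le> \<sigma>" "\<And>v. expectation (\<lambda>\<omega>. (g (G v \<omega>))\<^sup>2) \<le> \<sigma>\<^sup>2"
    and q: "1 \<le> q" "q \<le> 2"
    and int\<phi>: "\<And>u. length u = n \<Longrightarrow> integrable M (\<lambda>\<omega>. \<bar>\<phi> (brw G u \<omega>)\<bar> powr q)"
    and A: "(\<Sum>v | length v = Suc n. expectation (\<lambda>\<omega>. \<bar>\<phi> (brw G (butlast v) \<omega>)\<bar> powr q)) \<le> A"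
  shows integrable_increment: "integrable M D"
    and expectation_increment: "expectation D = 0"
    and expectation_abs_increment_le: "expectation (\<lambda>\<omega>. \<bar>D \<omega>\<bar>) \<le> \<sigma> * (sqrt A + A)"
proof -
  define V where "V = {v :: bool list. length v = Suc n}"
  have finV: "finite V"
    unfolding V_def by (rule finite_words)
  have lenV: "length (butlast v) < length v" "length (butlast v) = n" "length v = Suc n" if "v \<in> V" for v
    using that by (auto simp: V_def)
  define b where "b x = (if \<bar>\<phi> x\<bar> \<le> 1 then \<phi> x else 0)" for x
  define r where "r x = (if \<bar>\<phi> x\<bar> \<le> 1 then 0 else \<phi> x)" for x
  have [measurable]: "b \<in> borel_measurable borel" "r \<in> borel_measurable borel"
    unfolding b_def r_def by measurable
  have br: "\<phi> x = b x + r x" for x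
    by (simp add: b_def r_def)
  have b1: "\<bar>b x\<bar> \<le> 1" for x
    by (simp add: b_def)
  \<comment> \<open>Here \<open>q \<le> 2\<close> enters: for a base in (0, 1] powers decrease with
    the exponent. For bases above 1 they increase, so \<open>r1\<close> follows from
    \<open>1 \<le> q\<close>.\<close>
  have b2: "(b x)\<^sup>2 \<le> \<bar>\<phi> x\<bar> powr q" for x
  proof (cases "\<bar>\<phi> x\<bar> \<le> 1 \<and> \<phi> x \<noteq> 0")
    case True
    then have "\<bar>\<phi> x\<bar> powr 2 \<le> \<bar>\<phi> x\<bar> powr q"
      using q by (intro powr_mono') auto
    with True show ?thesis
      by (simp add: b_def)
  qed (auto simp: b_def)
  have r1: "\<bar>r x\<bar> \<le> \<bar>\<phi> x\<bar> powr q" for x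
    using powr_mono[of 1 q "\<bar>\<phi> x\<bar>"] q by (simp add: r_def)
  have g1: "integrable M (\<lambda>\<omega>. g (G v \<omega>))" for v
    by (rule square_integrable_imp_integrable) (use g2 in auto)
  have gabs: "expectation (\<lambda>\<omega>. \<bar>g (G v \<omega>)\<bar>) \<le> \<sigma>" for v
  proof (rule power2_le_imp_le)
    show "(expectation (\<lambda>\<omega>. \<bar>g (G v \<omega>)\<bar>))\<^sup>2 \<le> \<sigma>\<^sup>2"
      using expectation_square_le[of "\<lambda>\<omega>. \<bar>g (G v \<omega>)\<bar>"] g1[of v] g2[of v] \<sigma>(2)[of v] by simp
  qed (rule \<sigma>)
  have int_b: "integrable M (\<lambda>\<omega>. b (brw G u \<omega>))" for u
    by (rule integrable_const_bound[of _ 1]) (auto simp: b1)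
  have int_b2: "integrable M (\<lambda>\<omega>. (b (brw G u \<omega>))\<^sup>2)" for u
    by (rule integrable_const_bound[of _ 1]) (auto simp: b1 abs_square_le_1)
  have int_r: "integrable M (\<lambda>\<omega>. r (brw G u \<omega>))" if "length u = n" for u
    by (rule Bochner_Integration.integrable_bound[OF int\<phi>[OF that]]) (auto simp: r1)

  define B where "B \<omega> = (\<Sum>v\<in>V. b (brw G (butlast v) \<omega>) * g (G v \<omega>))" for \<omega>
  define R where "R \<omega> = (\<Sum>v\<in>V. r (brw G (butlast v) \<omega>) * g (G v \<omega>))" for \<omega>
  have D: "D = (\<lambda>\<omega>. B \<omega> + R \<omega>)"
    by (simp add: fun_eq_iff D_def B_def R_def V_def br sum.distrib distrib_right)
  have int_bg: "integrable M (\<lambda>\<omega>. b (brw G (butlast v) \<omega>) * g (G v \<omega>))"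
    and E_bg: "expectation (\<lambda>\<omega>. b (brw G (butlast v) \<omega>) * g (G v \<omega>)) = 0"
    and int_rg: "integrable M (\<lambda>\<omega>. r (brw G (butlast v) \<omega>) * g (G v \<omega>))"
    and E_rg: "expectation (\<lambda>\<omega>. r (brw G (butlast v) \<omega>) * g (G v \<omega>)) = 0"
    if "v \<in> V" for v
    using that by (auto intro!: integrable_brw_mult int_b int_r g1 lenV
        simp: expectation_brw_mult int_b int_r g1 lenV g0)
  have int_B: "integrable M B" and E_B: "expectation B = 0"
    unfolding B_def using int_bg E_bg by auto
  have int_R: "integrable M R" and E_R: "expectation R = 0"
    unfolding R_def using int_rg E_rg by auto
  show "integrable M D" "expectation D = 0"
    unfolding D using int_B int_R E_B E_R by auto

  have int_diag: "integrable M (\<lambda>\<omega>. (b (brw G (butlast v) \<omega>))\<^sup>2 * (g (G v \<omega>))\<^sup>2)"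
    and E_diag: "expectation (\<lambda>\<omega>. (b (brw G (butlast v) \<omega>))\<^sup>2 * (g (G v \<omega>))\<^sup>2) \<le>
      \<sigma>\<^sup>2 * expectation (\<lambda>\<omega>. \<bar>\<phi> (brw G (butlast v) \<omega>)\<bar> powr q)" if "v \<in> V" for v
  proof -
    show "integrable M (\<lambda>\<omega>. (b (brw G (butlast v) \<omega>))\<^sup>2 * (g (G v \<omega>))\<^sup>2)"
      using that int_b2 g2
      by (intro integrable_brw_mult[of "butlast v" v "\<lambda>x. (b x)\<^sup>2" "\<lambda>x. (g x)\<^sup>2"]) (auto simp: lenV)
    have "expectation (\<lambda>\<omega>. (b (brw G (butlast v) \<omega>))\<^sup>2 * (g (G v \<omega>))\<^sup>2) =
        expectation (\<lambda>\<omega>. (b (brw G (butlast v) \<omega>))\<^sup>2) * expectation (\<lambda>\<omega>. (g (G v \<omega>))\<^sup>2)"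
      using that int_b2 g2
      by (intro expectation_brw_mult[of "butlast v" v "\<lambda>x. (b x)\<^sup>2" "\<lambda>x. (g x)\<^sup>2"]) (auto simp: lenV)
    also have "\<dots> \<le> expectation (\<lambda>\<omega>. \<bar>\<phi> (brw G (butlast v) \<omega>)\<bar> powr q) * \<sigma>\<^sup>2"
      using that by (intro mult_mono integral_mono int_b2 int\<phi> b2 \<sigma> lenV) auto
    finally show "expectation (\<lambda>\<omega>. (b (brw G (butlast v) \<omega>))\<^sup>2 * (g (G v \<omega>))\<^sup>2) \<le>
        \<sigma>\<^sup>2 * expectation (\<lambda>\<omega>. \<bar>\<phi> (brw G (butlast v) \<omega>)\<bar> powr q)"
      by (simp add: mult.commute)
  qed
  let ?c = "\<lambda>v v' \<omega>. (b (brw G (butlast v) \<omega>) * g (G v \<omega>)) * (b (brw G (butlast v') \<omega>) * g (G v' \<omega>))"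
  have cross_eq: "?c v v' = (\<lambda>\<omega>. b (brw G (butlast v) \<omega>) * b (brw G (butlast v') \<omega>) * g (G v' \<omega>) * g (G v \<omega>))"
    for v v'
    by (simp add: fun_eq_iff mult_ac)
  \<comment> \<open>Off the diagonal the expectation factors, and the factor
    \<open>g (G v \<omega>)\<close> is centred.\<close>
  have int_cross: "integrable M (?c v v')" and E_cross: "expectation (?c v v') = 0"
    if "v \<in> V" "v' \<in> V" "v \<noteq> v'" for v v'
    unfolding cross_eq using that
    by (auto intro!: integrable_cross g1 b1 simp: expectation_cross g1 b1 g0 lenV)
  have diag_eq: "?c v v = (\<lambda>\<omega>. (b (brw G (butlast v) \<omega>))\<^sup>2 * (g (G v \<omega>))\<^sup>2)" for v
    by (simp add: fun_eq_iff power2_eq_square mult_ac)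
  have int_c: "integrable M (?c v v')" if "v \<in> V" "v' \<in> V" for v v'
    using int_cross[OF that] int_diag[OF that(1)] diag_eq[of v] by (cases "v = v'") auto
  have B2: "(B \<omega>)\<^sup>2 = (\<Sum>v\<in>V. \<Sum>v'\<in>V. ?c v v' \<omega>)" for \<omega>
    by (simp add: B_def power2_eq_square sum_product)
  have int_B2: "integrable M (\<lambda>\<omega>. (B \<omega>)\<^sup>2)"
    unfolding B2 by (intro Bochner_Integration.integrable_sum int_c)
  have "expectation (\<lambda>\<omega>. (B \<omega>)\<^sup>2) = (\<Sum>v\<in>V. \<Sum>v'\<in>V. expectation (?c v v'))"
    unfolding B2 by (subst Bochner_Integration.integral_sum)
      (auto intro!: Bochner_Integration.integrable_sum int_c sum.cong Bochner_Integration.integral_sum)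
  also have "\<dots> = (\<Sum>v\<in>V. \<Sum>v'\<in>V. if v' = v then expectation (?c v v) else 0)"
    by (intro sum.cong refl) (use E_cross in auto)
  also have "\<dots> = (\<Sum>v\<in>V. expectation (?c v v))"
    using finV by simp
  also have "\<dots> \<le> (\<Sum>v\<in>V. \<sigma>\<^sup>2 * expectation (\<lambda>\<omega>. \<bar>\<phi> (brw G (butlast v) \<omega>)\<bar> powr q))"
    unfolding diag_eq by (intro sum_mono E_diag)
  also have "\<dots> \<le> \<sigma>\<^sup>2 * A"
    unfolding sum_distrib_left[symmetric] using A by (intro mult_left_mono) (auto simp: V_def)
  finally have EB2: "expectation (\<lambda>\<omega>. (B \<omega>)\<^sup>2) \<le> \<sigma>\<^sup>2 * A" .
  \<comment> \<open>Cauchy-Schwarz turns the second moment into a bound in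
    \<open>L\<^sup>1\<close>.\<close>
  have "(expectation (\<lambda>\<omega>. \<bar>B \<omega>\<bar>))\<^sup>2 \<le> \<sigma>\<^sup>2 * A"
    using expectation_square_le[of "\<lambda>\<omega>. \<bar>B \<omega>\<bar>"] int_B int_B2 EB2 by simp
  then have "expectation (\<lambda>\<omega>. \<bar>B \<omega>\<bar>) \<le> sqrt (\<sigma>\<^sup>2 * A)"
    by (rule real_le_rsqrt)
  then have EB: "expectation (\<lambda>\<omega>. \<bar>B \<omega>\<bar>) \<le> \<sigma> * sqrt A"
    using \<sigma>(1) by (simp add: real_sqrt_mult)

  have E_abs: "expectation (\<lambda>\<omega>. \<bar>r (brw G (butlast v) \<omega>) * g (G v \<omega>)\<bar>) \<le>
      expectation (\<lambda>\<omega>. \<bar>\<phi> (brw G (butlast v) \<omega>)\<bar> powr q) * \<sigma>" if "v \<in> V" for v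
  proof -
    have "expectation (\<lambda>\<omega>. \<bar>r (brw G (butlast v) \<omega>) * g (G v \<omega>)\<bar>) =
        expectation (\<lambda>\<omega>. \<bar>r (brw G (butlast v) \<omega>)\<bar>) * expectation (\<lambda>\<omega>. \<bar>g (G v \<omega>)\<bar>)"
      unfolding abs_mult using that int_r g1
      by (intro expectation_brw_mult[of "butlast v" v "\<lambda>x. \<bar>r x\<bar>" "\<lambda>x. \<bar>g x\<bar>"]) (auto simp: lenV)
    also have "\<dots> \<le> expectation (\<lambda>\<omega>. \<bar>\<phi> (brw G (butlast v) \<omega>)\<bar> powr q) * \<sigma>"
      using that by (intro mult_mono integral_mono integrable_abs int_r int\<phi> r1 gabs lenV) auto
    finally show ?thesis .
  qed
  \<comment> \<open>No cancellation is used for the large weights.\<close>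
  have "expectation (\<lambda>\<omega>. \<bar>R \<omega>\<bar>) \<le>
      expectation (\<lambda>\<omega>. \<Sum>v\<in>V. \<bar>r (brw G (butlast v) \<omega>) * g (G v \<omega>)\<bar>)"
    unfolding R_def using int_rg
    by (intro integral_mono integrable_abs Bochner_Integration.integrable_sum sum_abs)
  also have "\<dots> = (\<Sum>v\<in>V. expectation (\<lambda>\<omega>. \<bar>r (brw G (butlast v) \<omega>) * g (G v \<omega>)\<bar>))"
    using int_rg by (intro Bochner_Integration.integral_sum integrable_abs)
  also have "\<dots> \<le> (\<Sum>v\<in>V. expectation (\<lambda>\<omega>. \<bar>\<phi> (brw G (butlast v) \<omega>)\<bar> powr q) * \<sigma>)"
    by (intro sum_mono E_abs)
  also have "\<dots> \<le> A * \<sigma>"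
    unfolding sum_distrib_right[symmetric] using A \<sigma>(1) by (intro mult_right_mono) (auto simp: V_def)
  finally have ER: "expectation (\<lambda>\<omega>. \<bar>R \<omega>\<bar>) \<le> A * \<sigma>" .

  have "expectation (\<lambda>\<omega>. \<bar>D \<omega>\<bar>) \<le> expectation (\<lambda>\<omega>. \<bar>B \<omega>\<bar> + \<bar>R \<omega>\<bar>)"
    unfolding D using int_B int_R
    by (intro integral_mono integrable_abs Bochner_Integration.integrable_add abs_triangle_ineq)
  also have "\<dots> = expectation (\<lambda>\<omega>. \<bar>B \<omega>\<bar>) + expectation (\<lambda>\<omega>. \<bar>R \<omega>\<bar>)"
    using int_B int_R by simp
  finally show "expectation (\<lambda>\<omega>. \<bar>D \<omega>\<bar>) \<le> \<sigma> * (sqrt A + A)"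
    using EB ER by (simp add: algebra_simps)
qed

end

section \<open>Moments of the weights below criticality\<close>

text \<open>The expression is the growth rate of the sum over a generation of the
  \<open>q\<close>-th moments of the weights, with an extra tilt \<open>d\<close>. At
  \<open>d = 0\<close> it equals \<open>(q - 1) (q \<beta>\<^sup>2 / 2 - ln 2)\<close>, negative for
  \<open>1 < q < 2 ln 2 / \<beta>\<^sup>2\<close>, and this interval is nonempty precisely because
  \<open>\<beta> < beta_c\<close>. Continuity in \<open>d\<close> then leaves room for a small tilt
  of either sign.\<close>

lemma subcritical_exponents:
  assumes "0 < \<beta>" "\<beta> < beta_c"
  obtains q \<delta> \<kappa> :: real where "1 \<le> q" "q \<le> 2" "0 < \<delta>" "0 < \<kappa>"
    and "\<And>d. d \<in> {\<delta>, - \<delta>} \<Longrightarrow>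
      (q * (\<beta> + d))\<^sup>2 / 2 - q * \<beta>\<^sup>2 / 2 - q * d * \<beta> - (q - 1) * ln 2 \<le> - \<kappa>"
proof -
  have "\<beta>\<^sup>2 < beta_c\<^sup>2"
    using assms by (intro power_strict_mono) auto
  then have "\<beta>\<^sup>2 < 2 * ln 2"
    by (simp add: beta_c_def)
  then have "1 < min 2 (2 * ln 2 / \<beta>\<^sup>2)"
    using assms by simp
  then obtain q where q: "1 < q" "q < min 2 (2 * ln 2 / \<beta>\<^sup>2)"
    using dense by blast
  define L where "L d = (q * (\<beta> + d))\<^sup>2 / 2 - q * \<beta>\<^sup>2 / 2 - q * d * \<beta> - (q - 1) * ln 2" for d
  define \<kappa> where "\<kappa> = (q - 1) * (ln 2 - q * \<beta>\<^sup>2 / 2) / 2"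
  have "q * \<beta>\<^sup>2 < 2 * ln 2"
    using q assms by (simp add: field_simps)
  then have \<kappa>: "0 < \<kappa>"
    using q by (simp add: \<kappa>_def)
  have "L 0 = - (2 * \<kappa>)"
    by (simp add: L_def \<kappa>_def field_simps power2_eq_square)
  moreover have "(L \<longlongrightarrow> L 0) (at 0)"
    unfolding L_def by (intro tendsto_intros) auto
  ultimately have "eventually (\<lambda>d. L d < - \<kappa>) (at 0)"
    using \<kappa> by (intro order_tendstoD) auto
  then obtain \<delta> where \<delta>: "0 < \<delta>" "\<And>d. d \<noteq> 0 \<Longrightarrow> \<bar>d\<bar> < \<delta> \<Longrightarrow> L d < - \<kappa>"
    by (auto simp: eventually_at dist_real_def)
  \<comment> \<open>The neighbourhood is open, so half its radius is used.\<close>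
  have "L d \<le> - \<kappa>" if "d \<in> {\<delta> / 2, - (\<delta> / 2)}" for d
    using \<delta>(2)[of d] that \<delta>(1) by auto
  then show thesis
    using that[of q "\<delta> / 2" \<kappa>] q \<kappa> \<delta>(1) by (auto simp: L_def)
qed

text \<open>The linear factor of the derivative martingale is absorbed into a small exponential
  tilt, so that only exponential moments are needed.\<close>

lemma abs_affine_le_exp:
  fixes y \<delta> p s :: real
  assumes "0 < \<delta>"
  shows "\<bar>p * y + s\<bar> \<le> (\<bar>p\<bar> / \<delta> + \<bar>s\<bar>) * exp (\<delta> * \<bar>y\<bar>)"
proof -
  have "\<delta> * \<bar>y\<bar> \<le> exp (\<delta> * \<bar>y\<bar>)"
    using exp_ge_add_one_self[of "\<delta> * \<bar>y\<bar>"] by linarith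
  then have "\<bar>y\<bar> \<le> exp (\<delta> * \<bar>y\<bar>) / \<delta>"
    using assms by (simp add: field_simps)
  then have "\<bar>p\<bar> * \<bar>y\<bar> \<le> \<bar>p\<bar> * (exp (\<delta> * \<bar>y\<bar>) / \<delta>)"
    by (intro mult_left_mono) auto
  moreover have "\<bar>s\<bar> * 1 \<le> \<bar>s\<bar> * exp (\<delta> * \<bar>y\<bar>)"
    using assms by (intro mult_left_mono) auto
  ultimately show ?thesis
    using abs_triangle_ineq[of "p * y" s] by (simp add: abs_mult algebra_simps)
qed

text \<open>The coefficient of a child's centred factor in \<open>tilted_sum_increment\<close>, as a
  function of the position \<open>x\<close> of its parent in generation \<open>n\<close>.\<close>

definition tilt_weight :: "real \<Rightarrow> real \<Rightarrow> real \<Rightarrow> nat \<Rightarrow> real \<Rightarrow> real" where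
  "tilt_weight \<beta> p s n x =
    1 / 2 ^ Suc n * exp (\<beta> * x - \<beta>\<^sup>2 / 2 * real n) * (p * (x - \<beta> * real n) + s)"

lemma measurable_tilt_weight [measurable]: "tilt_weight \<beta> p s n \<in> borel_measurable borel"
  unfolding tilt_weight_def by measurable

lemma tilt_weight_powr_le:
  assumes "0 < \<delta>" "1 \<le> q"
  shows "\<bar>tilt_weight \<beta> p s n x\<bar> powr q \<le>
    (\<bar>p\<bar> / \<delta> + \<bar>s\<bar>) powr q * exp (- q * real (Suc n) * ln 2) *
    (\<Sum>d\<in>{\<delta>, - \<delta>}. exp (- (q * \<beta>\<^sup>2 / 2 + q * d * \<beta>) * real n) * exp (q * (\<beta> + d) * x))"
proof -
  define K where "K = \<bar>p\<bar> / \<delta> + \<bar>s\<bar>"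
  define y where "y = x - \<beta> * real n"
  have K: "0 \<le> K"
    using assms by (simp add: K_def)
  have two: "1 / 2 ^ Suc n = exp (- real (Suc n) * ln 2)"
    by (simp add: exp_minus exp_of_nat_mult field_simps del: of_nat_Suc power_Suc)
  have "\<bar>tilt_weight \<beta> p s n x\<bar> =
      exp (- real (Suc n) * ln 2) * exp (\<beta> * x - \<beta>\<^sup>2 / 2 * real n) * \<bar>p * y + s\<bar>"
    unfolding tilt_weight_def two y_def[symmetric] by (simp add: abs_mult)
  also have "\<dots> \<le> exp (- real (Suc n) * ln 2) * exp (\<beta> * x - \<beta>\<^sup>2 / 2 * real n) * (K * exp (\<delta> * \<bar>y\<bar>))"
    using abs_affine_le_exp[OF assms(1), of p y s] by (intro mult_left_mono) (auto simp: K_def)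
  also have "\<dots> = K * exp (- real (Suc n) * ln 2 + (\<beta> * x - \<beta>\<^sup>2 / 2 * real n) + \<delta> * \<bar>y\<bar>)"
    by (simp only: exp_add) simp
  finally have "\<bar>tilt_weight \<beta> p s n x\<bar> powr q \<le>
      (K * exp (- real (Suc n) * ln 2 + (\<beta> * x - \<beta>\<^sup>2 / 2 * real n) + \<delta> * \<bar>y\<bar>)) powr q"
    using assms by (intro powr_mono2) auto
  also have "\<dots> = K powr q *
      exp (q * (- real (Suc n) * ln 2 + (\<beta> * x - \<beta>\<^sup>2 / 2 * real n) + \<delta> * \<bar>y\<bar>))"
    using K by (simp add: powr_mult powr_def[of "exp _"] del: of_nat_Suc)
  \<comment> \<open>The exponential of an absolute value is at most the sum over both signs; this
    leaves pure exponentials of \<open>x\<close>.\<close>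
  also have "\<dots> \<le> K powr q * (\<Sum>d\<in>{\<delta>, - \<delta>}.
      exp (q * (- real (Suc n) * ln 2 + (\<beta> * x - \<beta>\<^sup>2 / 2 * real n) + d * y)))"
    using assms by (intro mult_left_mono) (auto simp: abs_if)
  also have "\<dots> = K powr q * (\<Sum>d\<in>{\<delta>, - \<delta>}. exp (- q * real (Suc n) * ln 2) *
      (exp (- (q * \<beta>\<^sup>2 / 2 + q * d * \<beta>) * real n) * exp (q * (\<beta> + d) * x)))"
    unfolding exp_add[symmetric] y_def
    by (intro arg_cong2[where f = "(*)"] refl sum.cong arg_cong[where f = exp])
       (simp add: algebra_simps)
  finally show ?thesis
    by (simp only: K_def sum_distrib_left[symmetric] mult.assoc)
qed

context gaussian_tree
begin

text \<open>Once the Gaussian moment is evaluated, the rate per generation is the expression assumed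
  to be at most \<open>- \<kappa>\<close>. The factor \<open>1 / 2 ^ Suc n\<close> is kept apart
  because it cancels against the number of vertices in generation \<open>Suc n\<close>.\<close>

lemma
  assumes len: "length u = n" and "0 < \<delta>" and q: "1 \<le> q"
    and \<kappa>: "\<And>d. d \<in> {\<delta>, - \<delta>} \<Longrightarrow>
      (q * (\<beta> + d))\<^sup>2 / 2 - q * \<beta>\<^sup>2 / 2 - q * d * \<beta> - (q - 1) * ln 2 \<le> - \<kappa>"
  shows integrable_tilt_weight_powr:
      "integrable M (\<lambda>\<omega>. \<bar>tilt_weight \<beta> p s n (brw G u \<omega>)\<bar> powr q)"
    and expectation_tilt_weight_powr:
      "expectation (\<lambda>\<omega>. \<bar>tilt_weight \<beta> p s n (brw G u \<omega>)\<bar> powr q) \<le>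
        2 * (\<bar>p\<bar> / \<delta> + \<bar>s\<bar>) powr q / 2 ^ Suc n * exp (- \<kappa> * real n)"
proof -
  define K where "K = (\<bar>p\<bar> / \<delta> + \<bar>s\<bar>) powr q"
  let ?f = "\<lambda>\<omega>. K * exp (- q * real (Suc n) * ln 2) *
    (\<Sum>d\<in>{\<delta>, - \<delta>}. exp (- (q * \<beta>\<^sup>2 / 2 + q * d * \<beta>) * real n) * exp (q * (\<beta> + d) * brw G u \<omega>))"
  have int: "integrable M ?f"
    by (intro integrable_mult_right Bochner_Integration.integrable_sum integrable_exp_brw)
  have le: "\<bar>tilt_weight \<beta> p s n (brw G u \<omega>)\<bar> powr q \<le> ?f \<omega>" for \<omega>
    unfolding K_def by (rule tilt_weight_powr_le) fact+
  show int': "integrable M (\<lambda>\<omega>. \<bar>tilt_weight \<beta> p s n (brw G u \<omega>)\<bar> powr q)"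
    by (rule Bochner_Integration.integrable_bound[OF int]) (use le in \<open>auto intro!: AE_I2 order_trans[OF _ abs_ge_self]\<close>)
  have bound: "exp (- q * real (Suc n) * ln 2) *
      (exp (- (q * \<beta>\<^sup>2 / 2 + q * d * \<beta>) * real n) * exp ((q * (\<beta> + d))\<^sup>2 / 2 * real n)) \<le>
      exp (- real (Suc n) * ln 2) * exp (- \<kappa> * real n)" if "d \<in> {\<delta>, - \<delta>}" for d
  proof -
    \<comment> \<open>The multiple \<open>q (n + 1)\<close> of \<open>ln 2\<close> is split as
      \<open>(q - 1) n + (q - 1) + (n + 1)\<close>: the first part joins the rate, the second is
      dropped, the third is the factor kept apart.\<close>
    have "- q * real (Suc n) * ln 2 + (- (q * \<beta>\<^sup>2 / 2 + q * d * \<beta>) * real n + (q * (\<beta> + d))\<^sup>2 / 2 * real n) =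
        ((q * (\<beta> + d))\<^sup>2 / 2 - q * \<beta>\<^sup>2 / 2 - q * d * \<beta> - (q - 1) * ln 2) * real n
          - (q - 1) * ln 2 - real (Suc n) * ln 2"
      by (simp add: algebra_simps)
    also have "\<dots> \<le> - \<kappa> * real n - 0 - real (Suc n) * ln 2"
      using q by (intro diff_mono mult_right_mono \<kappa> that) auto
    finally show ?thesis
      unfolding exp_add[symmetric] exp_le_cancel_iff by linarith
  qed
  have "expectation (\<lambda>\<omega>. \<bar>tilt_weight \<beta> p s n (brw G u \<omega>)\<bar> powr q) \<le> expectation ?f"
    by (intro integral_mono int int' le)
  also have "expectation ?f = K * exp (- q * real (Suc n) * ln 2) *
    (\<Sum>d\<in>{\<delta>, - \<delta>}. exp (- (q * \<beta>\<^sup>2 / 2 + q * d * \<beta>) * real n) * exp ((q * (\<beta> + d))\<^sup>2 / 2 * real n))"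
    by (simp add: integrable_exp_brw expectation_exp_brw len del: of_nat_Suc sum.insert)
  also have "\<dots> = K * (\<Sum>d\<in>{\<delta>, - \<delta>}. exp (- q * real (Suc n) * ln 2) *
      (exp (- (q * \<beta>\<^sup>2 / 2 + q * d * \<beta>) * real n) * exp ((q * (\<beta> + d))\<^sup>2 / 2 * real n)))"
    by (simp only: sum_distrib_left mult.assoc)
  also have "\<dots> \<le> K * (\<Sum>d\<in>{\<delta>, - \<delta>}. exp (- real (Suc n) * ln 2) * exp (- \<kappa> * real n))"
    by (intro mult_left_mono sum_mono bound) (auto simp: K_def)
  \<comment> \<open>As \<open>\<delta>\<close> is positive, the two signs are distinct and the sum
    has two terms.\<close>
  also have "\<dots> = 2 * K / 2 ^ Suc n * exp (- \<kappa> * real n)"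
    using assms(2) by (simp add: exp_minus exp_of_nat_mult field_simps del: of_nat_Suc power_Suc)
  finally show "expectation (\<lambda>\<omega>. \<bar>tilt_weight \<beta> p s n (brw G u \<omega>)\<bar> powr q) \<le>
      2 * (\<bar>p\<bar> / \<delta> + \<bar>s\<bar>) powr q / 2 ^ Suc n * exp (- \<kappa> * real n)"
    by (simp add: K_def)
qed

text \<open>The summed \<open>q\<close>-th moments decay geometrically, and so do their square
  roots; \<open>expectation_abs_increment_le\<close> needs both.\<close>

lemma summable_weighted_increments:
  fixes g :: "real \<Rightarrow> real" and \<beta> :: real
  defines "D \<equiv> \<lambda>p s n \<omega>. \<Sum>v | length v = Suc n. tilt_weight \<beta> p s n (brw G (butlast v) \<omega>) * g (G v \<omega>)"
  assumes \<beta>: "0 < \<beta>" "\<beta> < beta_c" and [measurable]: "g \<in> borel_measurable borel"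
    and g2: "\<And>v. integrable M (\<lambda>\<omega>. (g (G v \<omega>))\<^sup>2)"
    and g0: "\<And>v. expectation (\<lambda>\<omega>. g (G v \<omega>)) = 0"
    and \<sigma>: "0 \<le> \<sigma>" "\<And>v. expectation (\<lambda>\<omega>. (g (G v \<omega>))\<^sup>2) \<le> \<sigma>\<^sup>2"
  shows "integrable M (D p s n)" and "expectation (D p s n) = 0"
    and "summable (\<lambda>n. expectation (\<lambda>\<omega>. \<bar>D p s n \<omega>\<bar>))"
proof -
  obtain q \<delta> \<kappa> where q: "1 \<le> q" "q \<le> 2" and \<delta>: "0 < \<delta>" and \<kappa>: "0 < \<kappa>"
    and ex: "\<And>d. d \<in> {\<delta>, - \<delta>} \<Longrightarrow>
      (q * (\<beta> + d))\<^sup>2 / 2 - q * \<beta>\<^sup>2 / 2 - q * d * \<beta> - (q - 1) * ln 2 \<le> - \<kappa>"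
    using subcritical_exponents[OF \<beta>] by metis
  define K where "K = 2 * (\<bar>p\<bar> / \<delta> + \<bar>s\<bar>) powr q"
  have A: "(\<Sum>v | length v = Suc n. expectation (\<lambda>\<omega>.
      \<bar>tilt_weight \<beta> p s n (brw G (butlast v) \<omega>)\<bar> powr q)) \<le> K * exp (- \<kappa> * real n)" for n
  proof -
    have "(\<Sum>v | length v = Suc n. expectation (\<lambda>\<omega>.
        \<bar>tilt_weight \<beta> p s n (brw G (butlast v) \<omega>)\<bar> powr q)) \<le>
        (\<Sum>v :: bool list | length v = Suc n. K / 2 ^ Suc n * exp (- \<kappa> * real n))"
      unfolding K_def by (intro sum_mono expectation_tilt_weight_powr \<delta> q ex) auto
    then show ?thesis
      by (simp add: card_words del: power_Suc)
  qed
  note inc = integrable_increment expectation_increment expectation_abs_increment_le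
  have *: "integrable M (D p s n) \<and> expectation (D p s n) = 0 \<and>
      expectation (\<lambda>\<omega>. \<bar>D p s n \<omega>\<bar>) \<le> \<sigma> * (sqrt (K * exp (- \<kappa> * real n)) + K * exp (- \<kappa> * real n))" for n
    unfolding D_def
    by (intro conjI inc[OF _ assms(4) g2 g0 \<sigma> q _ A])
       (auto intro!: integrable_tilt_weight_powr[OF _ \<delta> q(1) ex])
  then show "integrable M (D p s n)" "expectation (D p s n) = 0"
    by auto
  have e: "exp (- \<kappa> * real n) = exp (- \<kappa>) ^ n" for n
    by (rule exp_of_nat2_mult)
  have "summable (\<lambda>n. \<sigma> * (sqrt K * sqrt (exp (- \<kappa>)) ^ n + K * exp (- \<kappa>) ^ n))"
    using \<kappa> by (intro summable_mult summable_add summable_geometric) auto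
  then have "summable (\<lambda>n. \<sigma> * (sqrt (K * exp (- \<kappa> * real n)) + K * exp (- \<kappa> * real n)))"
    unfolding e by (simp add: real_sqrt_mult real_sqrt_power)
  then show "summable (\<lambda>n. expectation (\<lambda>\<omega>. \<bar>D p s n \<omega>\<bar>))"
    by (rule summable_comparison_test') (use * in auto)
qed

text \<open>Summable \<open>L\<^sup>1\<close> norms of the increments give almost sure convergence
  and also let the expectation pass through the series. The limit thus keeps the initial mean
  \<open>s\<close>, with no loss of mass.\<close>

lemma
  assumes \<beta>: "0 < \<beta>" "\<beta> < beta_c"
  shows AE_convergent_tilted_sum: "AE \<omega> in M. convergent (\<lambda>n. tilted_sum G \<beta> p s n \<omega>)"
    and integrable_lim_tilted_sum: "integrable M (\<lambda>\<omega>. lim (\<lambda>n. tilted_sum G \<beta> p s n \<omega>))"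
    and expectation_lim_tilted_sum: "expectation (\<lambda>\<omega>. lim (\<lambda>n. tilted_sum G \<beta> p s n \<omega>)) = s"
proof -
  define g1 where "g1 x = exp (\<beta> * x - \<beta>\<^sup>2 / 2) - 1" for x
  define g2 where "g2 x = exp (\<beta> * x - \<beta>\<^sup>2 / 2) * (x - \<beta>)" for x
  define D where "D g p s n \<omega> =
    (\<Sum>v | length v = Suc n. tilt_weight \<beta> p s n (brw G (butlast v) \<omega>) * g (G v \<omega>))"
    for g :: "real \<Rightarrow> real" and p s n \<omega>
  have [measurable]: "g1 \<in> borel_measurable borel" "g2 \<in> borel_measurable borel"
    unfolding g1_def g2_def by measurable
  have law: "expectation (\<lambda>\<omega>. h (G v \<omega>)) = (\<integral>x. std_normal_density x * h x \<partial>lborel)"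
    if "h \<in> borel_measurable borel" for h :: "real \<Rightarrow> real" and v
    using distributed_integral[OF distributed_G, of h v] that by simp
  have D: "integrable M (D g p s n) \<and> expectation (D g p s n) = 0 \<and>
      summable (\<lambda>n. expectation (\<lambda>\<omega>. \<bar>D g p s n \<omega>\<bar>))" if "g \<in> {g1, g2}" for g p s n
  proof -
    have [measurable]: "g \<in> borel_measurable borel"
      using that by auto
    \<comment> \<open>The second moment is taken under the common law of the weights, which makes
      \<open>\<sigma>\<close> uniform over the vertices.\<close>
    define \<sigma> where "\<sigma> = sqrt (\<integral>x. std_normal_density x * (g x)\<^sup>2 \<partial>lborel)"
    have 2: "integrable M (\<lambda>\<omega>. (g (G v \<omega>))\<^sup>2)" and 0: "expectation (\<lambda>\<omega>. g (G v \<omega>)) = 0" for v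
      using that square_integrable_exp_tilt expectation_exp_tilt square_integrable_exp_tilt_deriv
        expectation_exp_tilt_deriv by (auto simp: g1_def g2_def)
    have \<sigma>: "0 \<le> \<sigma>" "expectation (\<lambda>\<omega>. (g (G v \<omega>))\<^sup>2) \<le> \<sigma>\<^sup>2" for v
      by (simp_all add: \<sigma>_def law[of "\<lambda>x. (g x)\<^sup>2"])
    show ?thesis
      unfolding D_def
      by (intro conjI summable_weighted_increments[OF \<beta> _ 2 0 \<sigma>]) measurable
  qed
  define T where "T n \<omega> = tilted_sum G \<beta> p s n \<omega>" for n \<omega>
  define d where "d n \<omega> = D g1 p s n \<omega> + D g2 0 p n \<omega>" for n \<omega>
  have diff: "T (Suc n) \<omega> - T n \<omega> = d n \<omega>" for n \<omega>
    unfolding T_def d_def D_def g1_def g2_def tilt_weight_def by (rule tilted_sum_increment)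
  have T: "T n \<omega> = s + (\<Sum>i<n. d i \<omega>)" for n \<omega>
    using sum_lessThan_telescope[of "\<lambda>n. T n \<omega>" n] by (simp add: diff) (simp add: T_def tilted_sum_0)
  have int: "integrable M (d n)" and zero: "expectation (d n) = 0" for n
    unfolding d_def using D by auto
  have sum: "summable (\<lambda>n. expectation (\<lambda>\<omega>. \<bar>d n \<omega>\<bar>))"
  proof (rule summable_comparison_test')
    show "summable (\<lambda>n. expectation (\<lambda>\<omega>. \<bar>D g1 p s n \<omega>\<bar>) + expectation (\<lambda>\<omega>. \<bar>D g2 0 p n \<omega>\<bar>))"
      using D by (intro summable_add) auto
    fix n :: nat
    have "expectation (\<lambda>\<omega>. \<bar>d n \<omega>\<bar>) \<le> expectation (\<lambda>\<omega>. \<bar>D g1 p s n \<omega>\<bar> + \<bar>D g2 0 p n \<omega>\<bar>)"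
      using D int by (intro integral_mono integrable_abs Bochner_Integration.integrable_add)
        (auto simp: d_def)
    also have "\<dots> = expectation (\<lambda>\<omega>. \<bar>D g1 p s n \<omega>\<bar>) + expectation (\<lambda>\<omega>. \<bar>D g2 0 p n \<omega>\<bar>)"
      using D by (intro Bochner_Integration.integral_add integrable_abs) auto
    finally show "norm (expectation (\<lambda>\<omega>. \<bar>d n \<omega>\<bar>)) \<le>
        expectation (\<lambda>\<omega>. \<bar>D g1 p s n \<omega>\<bar>) + expectation (\<lambda>\<omega>. \<bar>D g2 0 p n \<omega>\<bar>)"
      by simp
  qed
  have AE_sum: "AE \<omega> in M. summable (\<lambda>n. \<bar>d n \<omega>\<bar>)"
    by (rule AE_summable_of_summable_integral[OF int sum])
  have lim: "AE \<omega> in M. (\<lambda>n. T n \<omega>) \<longlonglongrightarrow> s + (\<Sum>n. d n \<omega>)"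
    using AE_sum
  proof eventually_elim
    case (elim \<omega>)
    then have "(\<lambda>n. \<Sum>i<n. d i \<omega>) \<longlonglongrightarrow> (\<Sum>n. d n \<omega>)"
      by (rule summable_LIMSEQ[OF summable_rabs_cancel])
    then show ?case
      unfolding T by (intro tendsto_intros)
  qed
  then show "AE \<omega> in M. convergent (\<lambda>n. tilted_sum G \<beta> p s n \<omega>)"
    by eventually_elim (auto simp: convergent_def T_def)
  have AE_eq: "AE \<omega> in M. s + (\<Sum>n. d n \<omega>) = lim (\<lambda>n. tilted_sum G \<beta> p s n \<omega>)"
    using lim by eventually_elim (auto simp: T_def limI)
  have int_sum: "integrable M (\<lambda>\<omega>. \<Sum>n. d n \<omega>)"
    using integrable_suminf[OF int] AE_sum sum by simp
  then have int_lim: "integrable M (\<lambda>\<omega>. s + (\<Sum>n. d n \<omega>))"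
    by simp
  show "integrable M (\<lambda>\<omega>. lim (\<lambda>n. tilted_sum G \<beta> p s n \<omega>))"
    by (rule integrable_cong_AE_imp[OF int_lim]) (use AE_eq in \<open>auto elim: AE_mp\<close>)
  have "expectation (\<lambda>\<omega>. lim (\<lambda>n. tilted_sum G \<beta> p s n \<omega>)) = expectation (\<lambda>\<omega>. s + (\<Sum>n. d n \<omega>))"
    using int_lim by (intro integral_cong_AE) (use AE_eq in \<open>auto elim: AE_mp\<close>)
  also have "\<dots> = s + expectation (\<lambda>\<omega>. \<Sum>n. d n \<omega>)"
    using int_sum by (simp add: prob_space)
  also have "expectation (\<lambda>\<omega>. \<Sum>n. d n \<omega>) = 0"
    using integral_suminf[OF int] AE_sum sum by (simp add: zero)
  finally show "expectation (\<lambda>\<omega>. lim (\<lambda>n. tilted_sum G \<beta> p s n \<omega>)) = s"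
    by simp
qed

end

section \<open>Environments with a negative limit\<close>

text \<open>A set of deterministic environments, so that its probability depends only on their law.
  Convergence is built in, so that on the forced event the limits exist at every outcome. The
  threshold lies strictly between 0 and the mean -1 of the difference.\<close>

definition good_env :: "real \<Rightarrow> (bool list \<Rightarrow> real) set" where
  "good_env \<beta> = {x.
     convergent (\<lambda>n. tilted_sum (\<lambda>v x. x v) \<beta> 1 0 n x) \<and>
     convergent (\<lambda>n. tilted_sum (\<lambda>v x. x v) \<beta> 0 1 n x) \<and>
     lim (\<lambda>n. tilted_sum (\<lambda>v x. x v) \<beta> 1 0 n x) - lim (\<lambda>n. tilted_sum (\<lambda>v x. x v) \<beta> 0 1 n x) < - 1 / 2}"

lemma mem_good_env_iff:
  assumes "\<And>v. v \<noteq> [] \<Longrightarrow> x v = G v \<omega>"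
  shows "x \<in> good_env \<beta> \<longleftrightarrow>
    convergent (\<lambda>n. tilted_sum G \<beta> 1 0 n \<omega>) \<and> convergent (\<lambda>n. tilted_sum G \<beta> 0 1 n \<omega>) \<and>
    lim (\<lambda>n. tilted_sum G \<beta> 1 0 n \<omega>) - lim (\<lambda>n. tilted_sum G \<beta> 0 1 n \<omega>) < - 1 / 2"
proof -
  have "tilted_sum (\<lambda>v x. x v) \<beta> p s n x = tilted_sum G \<beta> p s n \<omega>" for p s n
    by (rule tilted_sum_cong) (rule assms)
  then show ?thesis
    by (simp add: good_env_def)
qed

lemma measurable_coordinate_tilted_sum [measurable]:
  "tilted_sum (\<lambda>v x. x v) \<beta> p s n \<in> borel_measurable (PiM UNIV (\<lambda>_. borel))"
  unfolding tilted_sum_def brw_def by measurable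

lemma good_env_sets [measurable]: "good_env \<beta> \<in> sets (PiM UNIV (\<lambda>_. borel))"
proof -
  \<comment> \<open>Over the reals convergence is the Cauchy property, which is visibly
    measurable.\<close>
  have [measurable]: "Measurable.pred (PiM UNIV (\<lambda>_. borel))
      (\<lambda>x. Cauchy (\<lambda>n. tilted_sum (\<lambda>v x. x v) \<beta> p s n x))" for p s
    unfolding pred_def by (rule sets_Collect_Cauchy) measurable
  have "{x \<in> space (PiM UNIV (\<lambda>_. borel)).
     Cauchy (\<lambda>n. tilted_sum (\<lambda>v x. x v) \<beta> 1 0 n x) \<and>
     Cauchy (\<lambda>n. tilted_sum (\<lambda>v x. x v) \<beta> 0 1 n x) \<and>
     lim (\<lambda>n. tilted_sum (\<lambda>v x. x v) \<beta> 1 0 n x) -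
     lim (\<lambda>n. tilted_sum (\<lambda>v x. x v) \<beta> 0 1 n x) < - 1 / 2} \<in> sets (PiM UNIV (\<lambda>_. borel))"
    by measurable
  then show ?thesis
    by (simp add: good_env_def Cauchy_convergent_iff space_PiM)
qed

context gaussian_tree
begin

lemma gaussian_tree_subtree: "gaussian_tree M (\<lambda>v. G (u @ v))"
proof unfold_locales
  \<comment> \<open>Distinct \<open>v\<close> give disjoint singletons \<open>{u @ v}\<close>, so
    independence survives the reindexing.\<close>
  have "indep_vars (\<lambda>v. PiM {u @ v} (\<lambda>_. borel)) (\<lambda>v \<omega>. restrict (\<lambda>w. G w \<omega>) {u @ v}) UNIV"
    by (rule indep_vars_restrict[OF indep_G]) (auto simp: disjoint_family_on_def)
  then have "indep_vars (\<lambda>_. borel) (\<lambda>v \<omega>. restrict (\<lambda>w. G w \<omega>) {u @ v} (u @ v)) UNIV"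
    by (rule indep_vars_compose2[where Y = "\<lambda>v x. x (u @ v)"]) measurable
  then show "indep_vars (\<lambda>_. borel) (\<lambda>v. G (u @ v)) UNIV"
    by simp
qed (rule distributed_G)

lemma measurable_environment [measurable]: "(\<lambda>\<omega> v. G v \<omega>) \<in> measurable M (PiM UNIV (\<lambda>_. borel))"
  by (rule measurable_PiM_single') auto

lemma distr_environment:
  "distr M (PiM UNIV (\<lambda>_. borel)) (\<lambda>\<omega> v. G v \<omega>) = PiM UNIV (\<lambda>_. density lborel std_normal_density)"
proof -
  have "distr M borel (G v) = density lborel std_normal_density" for v
    using distributed_distr_eq_density[OF distributed_G[of v]]
    by (metis distr_cong sets_lborel)
  then show ?thesis
    using indep_vars_iff_distr_eq_PiM[where I = UNIV and M' = "\<lambda>_. borel" and X = G] indep_G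
    by (simp add: restrict_UNIV)
qed

definition good_prob :: "real \<Rightarrow> real" where
  "good_prob \<beta> = prob {\<omega> \<in> space M. (\<lambda>v. G v \<omega>) \<in> good_env \<beta>}"

text \<open>The right-hand side mentions neither \<open>M\<close> nor \<open>G\<close>, so different
  interpretations of the locale share one value; \<open>good_prob_subtree\<close> rests on
  this.\<close>

lemma good_prob_eq:
  "good_prob \<beta> = measure (PiM UNIV (\<lambda>_. density lborel std_normal_density)) (good_env \<beta>)"
  unfolding good_prob_def distr_environment[symmetric]
  by (subst measure_distr) (auto intro!: arg_cong[where f = prob])

lemma good_prob_subtree:
  "prob {\<omega> \<in> space M. (\<lambda>v. G (u @ v) \<omega>) \<in> good_env \<beta>} = good_prob \<beta>"
proof -
  interpret sub: gaussian_tree M "\<lambda>v. G (u @ v)"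
    by (rule gaussian_tree_subtree)
  show ?thesis
    using sub.good_prob_eq[of \<beta>] good_prob_eq[of \<beta>] by (simp add: sub.good_prob_def)
qed

text \<open>Otherwise the difference of the limits would almost surely be at least -1/2, although
  its mean is -1.\<close>

lemma good_prob_pos:
  assumes \<beta>: "0 < \<beta>" "\<beta> < beta_c"
  shows "0 < good_prob \<beta>"
proof (rule ccontr)
  define Z where "Z \<omega> = lim (\<lambda>n. tilted_sum G \<beta> 1 0 n \<omega>)" for \<omega>
  define W where "W \<omega> = lim (\<lambda>n. tilted_sum G \<beta> 0 1 n \<omega>)" for \<omega>
  assume "\<not> 0 < good_prob \<beta>"
  then have "prob {\<omega> \<in> space M. (\<lambda>v. G v \<omega>) \<in> good_env \<beta>} = 0"
    by (simp add: good_prob_def not_less measure_le_0_iff)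
  then have "AE \<omega> in M. (\<lambda>v. G v \<omega>) \<notin> good_env \<beta>"
    by (subst (asm) prob_eq_0) auto
  then have ge: "AE \<omega> in M. - 1 / 2 \<le> Z \<omega> - W \<omega>"
    using AE_convergent_tilted_sum[OF \<beta>, of 1 0] AE_convergent_tilted_sum[OF \<beta>, of 0 1]
  proof eventually_elim
    case (elim \<omega>)
    then show ?case
      using mem_good_env_iff[of "\<lambda>v. G v \<omega>" G \<omega> \<beta>] by (simp add: Z_def W_def)
  qed
  have int: "integrable M Z" "integrable M W"
    unfolding Z_def W_def by (intro integrable_lim_tilted_sum \<beta>)+
  have exp: "expectation Z = 0" "expectation W = 1"
    unfolding Z_def W_def by (intro expectation_lim_tilted_sum \<beta>)+
  have "- 1 / 2 \<le> expectation (\<lambda>\<omega>. Z \<omega> - W \<omega>)"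
    using integral_mono_AE[OF _ _ ge] int by (simp add: prob_space)
  also have "\<dots> = - 1"
    using int exp by simp
  finally show False
    by simp
qed

section \<open>Forcing the first generations\<close>

text \<open>The window has length \<open>\<delta>\<close> and, for \<open>\<delta> \<le> 1\<close>,
  lies within distance \<open>\<beta> + 2\<close> of the origin, where the density is at least its
  value at that distance.\<close>

lemma window_prob_ge:
  assumes "0 < \<beta>" "0 < \<delta>" "\<delta> \<le> 1"
  shows "std_normal_density (\<beta> + 2) * \<delta> \<le> prob {\<omega> \<in> space M. G v \<omega> \<in> {\<beta> - 2 * \<delta>..\<beta> - \<delta>}}"
proof -
  define m where "m = std_normal_density (\<beta> + 2)"
  have le: "m \<le> std_normal_density x" if "x \<in> {\<beta> - 2 * \<delta>..\<beta> - \<delta>}" for x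
  proof -
    have "\<bar>x\<bar> \<le> \<bar>\<beta> + 2\<bar>"
      using that assms by auto
    then have "x\<^sup>2 \<le> (\<beta> + 2)\<^sup>2"
      by (rule abs_le_square_iff[THEN iffD1])
    then show ?thesis
      by (simp add: m_def std_normal_density_def divide_right_mono)
  qed
  have "ennreal (m * \<delta>) = (\<integral>\<^sup>+x. ennreal m * indicator {\<beta> - 2 * \<delta>..\<beta> - \<delta>} x \<partial>lborel)"
    using assms by (simp add: nn_integral_cmult_indicator ennreal_mult'' m_def)
  also have "\<dots> \<le> (\<integral>\<^sup>+x. ennreal (std_normal_density x) * indicator {\<beta> - 2 * \<delta>..\<beta> - \<delta>} x \<partial>lborel)"
    by (intro nn_integral_mono) (auto split: split_indicator intro!: ennreal_leI le)
  also have "\<dots> = emeasure M (G v -` {\<beta> - 2 * \<delta>..\<beta> - \<delta>} \<inter> space M)"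
    by (rule distributed_emeasure[OF distributed_G, symmetric]) simp
  also have "\<dots> = ennreal (prob {\<omega> \<in> space M. G v \<omega> \<in> {\<beta> - 2 * \<delta>..\<beta> - \<delta>}})"
    unfolding emeasure_eq_measure by (intro arg_cong[where f = ennreal] arg_cong[where f = prob]) auto
  finally show ?thesis
    by (simp add: m_def)
qed

text \<open>The window width halves with each generation towards the root. The displacements along a
  path then sum geometrically instead of growing with \<open>N\<close>, and the narrowest windows
  are imposed on the fewest weights.\<close>

definition forced :: "real \<Rightarrow> nat \<Rightarrow> 'a set" where
  "forced \<beta> N = {\<omega> \<in> space M.
    (\<forall>v. length v \<le> N \<longrightarrow>
      G v \<omega> \<in> {\<beta> - 2 * (1 / 2) ^ (N - length v)..\<beta> - (1 / 2) ^ (N - length v)}) \<and>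
    (\<forall>u. length u = N \<longrightarrow> (\<lambda>w. G (u @ w) \<omega>) \<in> good_env \<beta>)}"

text \<open>The conditions concern disjoint blocks of weights: single vertices up to generation
  \<open>N\<close>, and the strict descendants of each vertex of generation
  \<open>N\<close>.\<close>

lemma prob_forced:
  "prob (forced \<beta> N) =
    (\<Prod>v | length v \<le> N. prob {\<omega> \<in> space M.
      G v \<omega> \<in> {\<beta> - 2 * (1 / 2) ^ (N - length v)..\<beta> - (1 / 2) ^ (N - length v)}}) *
    good_prob \<beta> ^ 2 ^ N"
proof -
  define I where "I k = {\<beta> - 2 * (1 / 2) ^ (N - k)..\<beta> - (1 / 2) ^ (N - k)}" for k
  \<comment> \<open>The flag selects the kind of block. A subtree block leaves out its own root,
    whose weight already forms a singleton block.\<close>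
  define K where "K j = (if fst j then {snd j @ w |w. w \<noteq> []} else {snd j})" for j :: "bool \<times> bool list"
  define F where "F = {v :: bool list. length v \<le> N}"
  define U where "U = {u :: bool list. length u = N}"
  define L where "L = Pair False ` F \<union> Pair True ` U"
  define R where "R j \<omega> = restrict (\<lambda>w. G w \<omega>) (K j)" for j :: "bool \<times> bool list" and \<omega>
  \<comment> \<open>A subtree block becomes a full environment once the missing root value is filled
    with 0; by \<open>mem_good_env_iff\<close> this value has no influence.\<close>
  define e where "e u x = (\<lambda>w. if w = [] then 0 else x (u @ w))" for u :: "bool list" and x :: "bool list \<Rightarrow> real"
  define A where "A j = (if fst j then {x \<in> space (PiM (K j) (\<lambda>_. borel)). e (snd j) x \<in> good_env \<beta>}
    else {x \<in> space (PiM (K j) (\<lambda>_. borel)). x (snd j) \<in> I (length (snd j))})" for j :: "bool \<times> bool list"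
  have fin: "finite F" "finite U"
    unfolding F_def U_def by (rule finite_words_le finite_words)+
  \<comment> \<open>A word determines the block containing it, hence the blocks are
    disjoint.\<close>
  have key: "j = (if length w \<le> N then (False, w) else (True, take N w))" if "j \<in> L" "w \<in> K j" for j w
    using that by (cases j; cases "fst j") (auto simp: L_def F_def U_def K_def)
  have disj: "disjoint_family_on K L"
    unfolding disjoint_family_on_def using key by blast
  have ind: "indep_vars (\<lambda>j. PiM (K j) (\<lambda>_. borel)) R L"
    unfolding R_def by (rule indep_vars_restrict[OF indep_G _ disj]) simp
  have A: "A j \<in> sets (PiM (K j) (\<lambda>_. borel))" if "j \<in> L" for j
  proof (cases "fst j")
    case True
    have "(\<lambda>x. e (snd j) x w) \<in> borel_measurable (PiM (K j) (\<lambda>_. borel))" for w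
      using True by (cases "w = []") (auto simp: e_def K_def intro!: measurable_component_singleton)
    then have "e (snd j) \<in> measurable (PiM (K j) (\<lambda>_. borel)) (PiM UNIV (\<lambda>_. borel))"
      by (intro measurable_PiM_single'[of UNIV "\<lambda>w x. e (snd j) x w" _ "\<lambda>_. borel", simplified]) auto
    then have "{x \<in> space (PiM (K j) (\<lambda>_. borel)). e (snd j) x \<in> good_env \<beta>} \<in> sets (PiM (K j) (\<lambda>_. borel))"
      by measurable
    with True show ?thesis
      by (simp add: A_def)
  next
    case False
    then have "snd j \<in> K j"
      by (simp add: K_def)
    then have "(\<lambda>x. x (snd j)) \<in> borel_measurable (PiM (K j) (\<lambda>_. borel :: real measure))"
      by (rule measurable_component_singleton)
    then have "{x \<in> space (PiM (K j) (\<lambda>_. borel)). x (snd j) \<in> I (length (snd j))} \<in> sets (PiM (K j) (\<lambda>_. borel))"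
      unfolding I_def by measurable
    with False show ?thesis
      by (simp add: A_def)
  qed
  have ev: "R (False, v) -` A (False, v) \<inter> space M = {\<omega> \<in> space M. G v \<omega> \<in> I (length v)}" for v
    by (auto simp: R_def A_def K_def space_PiM)
  have good: "e u (R (True, u) \<omega>) \<in> good_env \<beta> \<longleftrightarrow> (\<lambda>w. G (u @ w) \<omega>) \<in> good_env \<beta>" for u \<omega>
    using mem_good_env_iff[of "e u (R (True, u) \<omega>)" "\<lambda>w. G (u @ w)" \<omega> \<beta>]
      mem_good_env_iff[of "\<lambda>w. G (u @ w) \<omega>" "\<lambda>w. G (u @ w)" \<omega> \<beta>]
    by (simp add: e_def R_def K_def)
  have eu: "R (True, u) -` A (True, u) \<inter> space M = {\<omega> \<in> space M. (\<lambda>w. G (u @ w) \<omega>) \<in> good_env \<beta>}" for u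
    by (auto simp: A_def good) (auto simp: R_def space_PiM)
  have Nil: "[] \<in> F"
    by (simp add: F_def)
  have "forced \<beta> N = (\<Inter>v\<in>F. {\<omega> \<in> space M. G v \<omega> \<in> I (length v)}) \<inter>
      (\<Inter>u\<in>U. {\<omega> \<in> space M. (\<lambda>w. G (u @ w) \<omega>) \<in> good_env \<beta>})"
    using Nil unfolding forced_def I_def F_def U_def by blast
  also have "\<dots> = (\<Inter>j\<in>L. R j -` A j \<inter> space M)"
    unfolding L_def INT_Un image_image ev[symmetric] eu[symmetric] by simp
  also have "prob \<dots> = (\<Prod>j\<in>L. prob (R j -` A j \<inter> space M))"
  proof (rule indep_varsD_finite[OF ind])
    show "L \<noteq> {}"
      using Nil by (auto simp: L_def)
  qed (use fin A in \<open>auto simp: L_def\<close>)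
  also have "\<dots> = (\<Prod>v\<in>F. prob (R (False, v) -` A (False, v) \<inter> space M)) *
      (\<Prod>u\<in>U. prob (R (True, u) -` A (True, u) \<inter> space M))"
    unfolding L_def using fin by (subst prod.union_disjoint) (auto simp: prod.reindex inj_on_def)
  also have "\<dots> = (\<Prod>v\<in>F. prob {\<omega> \<in> space M. G v \<omega> \<in> I (length v)}) * good_prob \<beta> ^ 2 ^ N"
    unfolding ev eu by (simp add: good_prob_subtree U_def card_words)
  finally show ?thesis
    by (simp add: I_def F_def)
qed

lemma deriv_mart_limit_forced:
  assumes "0 < \<beta>" "1 \<le> N" and \<omega>: "\<omega> \<in> forced \<beta> N"
  shows "deriv_mart_limit G \<beta> \<omega> \<le> - (1 / 2) * exp (\<beta>\<^sup>2 / 2 * real N - 4 * \<beta>)"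
proof -
  define W where "W u = lim (\<lambda>n. tilted_sum (\<lambda>v. G (u @ v)) \<beta> 0 1 n \<omega>)" for u
  define Z where "Z u = lim (\<lambda>n. tilted_sum (\<lambda>v. G (u @ v)) \<beta> 1 0 n \<omega>)" for u
  define F where "F u = exp (\<beta> * brw G u \<omega> - \<beta>\<^sup>2 / 2 * real N)" for u
  define X where "X u = brw G u \<omega> - \<beta> * real N" for u
  define c where "c = exp (\<beta>\<^sup>2 / 2 * real N - 4 * \<beta>)"
  have lims: "(\<lambda>n. tilted_sum (\<lambda>v. G (u @ v)) \<beta> 0 1 n \<omega>) \<longlonglongrightarrow> W u"
      "(\<lambda>n. tilted_sum (\<lambda>v. G (u @ v)) \<beta> 1 0 n \<omega>) \<longlonglongrightarrow> Z u" "Z u - W u < - 1 / 2"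
    if "length u = N" for u
    using \<omega> that mem_good_env_iff[of "\<lambda>w. G (u @ w) \<omega>" "\<lambda>w. G (u @ w)" \<omega> \<beta>]
    by (auto simp: forced_def W_def Z_def convergent_LIMSEQ_iff)
  have "(\<lambda>n. deriv_mart G \<beta> (N + n) \<omega>) \<longlonglongrightarrow>
      1 / 2 ^ N * (\<Sum>u | length u = N. F u * (X u * W u + Z u))"
    unfolding deriv_mart_eq_tilted_sum tilted_sum_add F_def[symmetric] X_def[symmetric]
    by (intro tendsto_intros lims) auto
  then have "(\<lambda>n. deriv_mart G \<beta> n \<omega>) \<longlonglongrightarrow>
      1 / 2 ^ N * (\<Sum>u | length u = N. F u * (X u * W u + Z u))"
    by (rule LIMSEQ_offset[where k = N, unfolded add.commute[of _ N]])
  then have lim: "deriv_mart_limit G \<beta> \<omega> =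
      1 / 2 ^ N * (\<Sum>u | length u = N. F u * (X u * W u + Z u))"
    unfolding deriv_mart_limit_def by (rule limI)
  have geom: "(\<Sum>i<N. (1 / 2) ^ (N - Suc i)) = 2 - 2 * (1 / 2 :: real) ^ N"
    unfolding sum.nat_diff_reindex[of "\<lambda>i. (1 / 2) ^ i"] by (induction N) simp_all
  have X: "X u \<le> - 1" "- 4 \<le> X u" if "length u = N" for u
  proof -
    have G: "G (take (Suc i) u) \<omega> \<in> {\<beta> - 2 * (1 / 2) ^ (N - Suc i)..\<beta> - (1 / 2) ^ (N - Suc i)}"
      if "i < N" for i
    proof -
      have "length (take (Suc i) u) = Suc i"
        using \<open>i < N\<close> \<open>length u = N\<close> by simp
      then show ?thesis
        using \<omega> \<open>i < N\<close> unfolding forced_def by (auto dest!: spec[of _ "take (Suc i) u"])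
    qed
    have "brw G u \<omega> \<le> (\<Sum>i<N. \<beta> - (1 / 2) ^ (N - Suc i))"
      unfolding brw_eq_sum_take \<open>length u = N\<close> using G by (intro sum_mono) auto
    also have "\<dots> = \<beta> * real N - (2 - 2 * (1 / 2) ^ N)"
      by (simp add: sum_subtractf geom)
    finally have "X u \<le> 2 * (1 / 2) ^ N - 2"
      by (simp add: X_def)
    \<comment> \<open>With \<open>1 \<le> N\<close> the total displacement is at least 1.\<close>
    also have "(1 / 2 :: real) ^ N \<le> (1 / 2) ^ 1"
      using \<open>1 \<le> N\<close> by (intro power_decreasing) auto
    finally show "X u \<le> - 1"
      by simp
    have "\<beta> * real N - 2 * (2 - 2 * (1 / 2) ^ N) = (\<Sum>i<N. \<beta> - 2 * (1 / 2) ^ (N - Suc i))"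
      by (simp add: sum_subtractf geom[symmetric] sum_distrib_left[symmetric])
    also have "\<dots> \<le> brw G u \<omega>"
      unfolding brw_eq_sum_take \<open>length u = N\<close> using G by (intro sum_mono) auto
    finally have "4 * (1 / 2) ^ N - 4 \<le> X u"
      by (simp add: X_def)
    moreover have "0 \<le> (1 / 2 :: real) ^ N"
      by simp
    ultimately show "- 4 \<le> X u"
      by linarith
  qed
  have "F u * (X u * W u + Z u) \<le> - (1 / 2) * c" if u: "length u = N" for u
  proof -
    \<comment> \<open>Positivity of \<open>W u\<close> turns the upper bound -1 on
      \<open>X u\<close> into a bound by \<open>Z u - W u\<close>, which is less than -1/2.\<close>
    have "0 \<le> W u"
      by (rule LIMSEQ_le_const[OF lims(1)[OF u]]) (auto simp: tilted_sum_def intro!: sum_nonneg divide_nonneg_nonneg)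
    then have "X u * W u \<le> - 1 * W u"
      using X[OF u] by (intro mult_right_mono) auto
    then have "X u * W u + Z u \<le> - (1 / 2)"
      using lims(3)[OF u] by simp
    then have "F u * (X u * W u + Z u) \<le> F u * (- (1 / 2))"
      by (intro mult_left_mono) (auto simp: F_def)
    \<comment> \<open>Since \<open>brw G u \<omega>\<close> is \<open>X u + \<beta> N\<close>,
      \<open>F u\<close> equals \<open>exp (\<beta> * X u + \<beta>\<^sup>2 N / 2)\<close>: the
      drift has changed sign, and -4 bounds the correction.\<close>
    moreover have "c \<le> F u"
    proof -
      have "\<beta> * - 4 \<le> \<beta> * X u"
        using X[OF u] assms(1) by (intro mult_left_mono) auto
      then show ?thesis
        by (simp add: c_def F_def X_def algebra_simps power2_eq_square)
    qed
    ultimately show ?thesis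
      by simp
  qed
  then have "(\<Sum>u | length u = N. F u * (X u * W u + Z u)) \<le> (\<Sum>u :: bool list | length u = N. - (1 / 2) * c)"
    by (intro sum_mono) auto
  then have "1 / 2 ^ N * (\<Sum>u | length u = N. F u * (X u * W u + Z u)) \<le> 1 / 2 ^ N * (2 ^ N * (- (1 / 2) * c))"
    by (intro mult_left_mono) (simp_all add: card_words)
  then show ?thesis
    unfolding lim c_def by simp
qed

end

section \<open>Total cost of the forcing\<close>

lemma sum_words_le:
  fixes f :: "nat \<Rightarrow> real"
  shows "(\<Sum>v :: bool list | length v \<le> N. f (length v)) = (\<Sum>k\<le>N. 2 ^ k * f k)"
proof (induction N)
  case (Suc N)
  have "{v :: bool list. length v \<le> Suc N} = {v. length v \<le> N} \<union> {v. length v = Suc N}"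
    by auto
  then have "(\<Sum>v :: bool list | length v \<le> Suc N. f (length v)) =
      (\<Sum>v :: bool list | length v \<le> N. f (length v)) + (\<Sum>v :: bool list | length v = Suc N. f (length v))"
    using finite_words[of "Suc N"] finite_words_le[of N] by (simp only:) (subst sum.union_disjoint, auto)
  also have "(\<Sum>v :: bool list | length v = Suc N. f (length v)) = 2 ^ Suc N * f (Suc N)"
    by (simp add: card_words del: power_Suc)
  finally show ?case
    using Suc.IH by simp
qed simp

text \<open>The factor \<open>N - k\<close> is large only where \<open>2 ^ k\<close> is small, so
  the sum is of order \<open>2 ^ N\<close> without an extra factor \<open>N\<close>.\<close>

lemma sum_window_costs:
  fixes a b :: real
  shows "(\<Sum>k\<le>N. 2 ^ k * (a + (real N - real k) * b)) = a * (2 ^ Suc N - 1) + b * (2 ^ Suc N - real N - 2)"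
proof (induction N)
  case (Suc N)
  have pow: "(\<Sum>k\<le>N. (2::real) ^ k) = 2 ^ Suc N - 1"
    by (induction N) simp_all
  \<comment> \<open>Raising \<open>N\<close> by one adds \<open>b\<close> per vertex of the earlier
    generations; in the new generation only \<open>a\<close> is paid.\<close>
  have "(\<Sum>k\<le>Suc N. 2 ^ k * (a + (real (Suc N) - real k) * b)) =
      (\<Sum>k\<le>N. 2 ^ k * (a + (real N - real k) * b) + b * 2 ^ k) + 2 ^ Suc N * a"
    by (simp add: algebra_simps)
  also have "\<dots> = a * (2 ^ Suc N - 1) + b * (2 ^ Suc N - real N - 2) + b * (2 ^ Suc N - 1) + 2 ^ Suc N * a"
    unfolding sum.distrib Suc.IH sum_distrib_left[symmetric] pow by simp
  finally show ?case
    by (simp add: algebra_simps)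
qed simp

lemma (in gaussian_tree) prob_forced_ge:
  assumes \<beta>: "0 < \<beta>" "\<beta> < beta_c"
  obtains \<kappa> where "0 < \<kappa>" "\<And>N. exp (- \<kappa> * 2 ^ N) \<le> prob (forced \<beta> N)"
proof -
  define m where "m = std_normal_density (\<beta> + 2)"
  define p where "p = good_prob \<beta>"
  have m: "0 < m"
    by (simp add: m_def normal_density_pos)
  have p: "0 < p"
    using good_prob_pos[OF \<beta>] by (simp add: p_def)
  define \<kappa> where "\<kappa> = 2 * \<bar>ln m\<bar> + 2 * ln 2 + \<bar>ln p\<bar>"
  have "0 < \<kappa>"
    using ln_gt_zero[of "2::real"] by (simp add: \<kappa>_def add_nonneg_pos add_pos_nonneg)
  moreover have "exp (- \<kappa> * 2 ^ N) \<le> prob (forced \<beta> N)" for N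
  proof -
    \<comment> \<open>The negative logarithm of the lower bound \<open>m * (1 / 2) ^ (N - k)\<close>
      for one window of generation \<open>k\<close>.\<close>
    define f where "f k = - ln m + (real N - real k) * ln 2" for k
    have f: "exp (- f k) = m * (1 / 2) ^ (N - k)" if "k \<le> N" for k
      using m that
      by (simp add: f_def exp_diff exp_minus exp_add exp_of_nat_mult of_nat_diff[symmetric] power_one_over field_simps del: of_nat_diff)
    have "exp (- (\<Sum>k\<le>N. 2 ^ k * f k)) = exp (\<Sum>v :: bool list | length v \<le> N. - f (length v))"
      by (simp add: sum_words_le sum_negf)
    also have "\<dots> = (\<Prod>v :: bool list | length v \<le> N. m * (1 / 2) ^ (N - length v))"
      unfolding exp_sum[OF finite_words_le] by (intro prod.cong) (auto simp: f)
    also have "\<dots> \<le> (\<Prod>v | length v \<le> N. prob {\<omega> \<in> space M.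
        G v \<omega> \<in> {\<beta> - 2 * (1 / 2) ^ (N - length v)..\<beta> - (1 / 2) ^ (N - length v)}})"
      using m window_prob_ge[OF \<beta>(1)] unfolding m_def
      by (intro prod_mono conjI) (simp_all add: power_le_one del: atLeastAtMost_iff)
    finally have "exp (- (\<Sum>k\<le>N. 2 ^ k * f k)) * p ^ 2 ^ N \<le> prob (forced \<beta> N)"
      unfolding prob_forced p_def[symmetric] using p by (intro mult_right_mono) auto
    moreover have "p ^ 2 ^ N = exp (2 ^ N * ln p)"
      using p exp_of_nat_mult[of "2 ^ N" "ln p"] by simp
    moreover have "- \<kappa> * 2 ^ N \<le> - (\<Sum>k\<le>N. 2 ^ k * f k) + 2 ^ N * ln p"
    proof -
      define X where "X = - ln m * (2 ^ Suc N - 1)"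
      define Y where "Y = ln 2 * (2 ^ Suc N - real N - 2)"
      have "X \<le> \<bar>ln m\<bar> * 2 ^ Suc N"
        unfolding X_def using one_le_power[of "2 :: real" "Suc N"] by (intro mult_mono) auto
      moreover have "Y \<le> ln 2 * 2 ^ Suc N"
        unfolding Y_def by (intro mult_left_mono) auto
      moreover have "2 ^ N * (- \<bar>ln p\<bar>) \<le> 2 ^ N * ln p"
        by (intro mult_left_mono) auto
      moreover have "- \<kappa> * 2 ^ N = - (\<bar>ln m\<bar> * 2 ^ Suc N) - ln 2 * 2 ^ Suc N + 2 ^ N * (- \<bar>ln p\<bar>)"
        by (simp add: \<kappa>_def algebra_simps)
      ultimately show ?thesis
        unfolding f_def sum_window_costs X_def[symmetric] Y_def[symmetric] by linarith
    qed
    then have "exp (- \<kappa> * 2 ^ N) \<le> exp (- (\<Sum>k\<le>N. 2 ^ k * f k) + 2 ^ N * ln p)"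
      by simp
    ultimately show ?thesis
      unfolding exp_add by simp
  qed
  ultimately show thesis
    by (rule that)
qed

section \<open>Choosing the generation for a given level\<close>

theorem theorem1p1:
  fixes M :: "'a measure" and G :: "bool list \<Rightarrow> 'a \<Rightarrow> real" and \<beta> \<gamma> :: real
  assumes "prob_space M"
    and "prob_space.indep_vars M (\<lambda>_. borel) G UNIV"
    and "\<And>v. distributed M lborel (G v) std_normal_density"
    and "0 < \<beta>" and "\<beta> < beta_c"
    and "\<gamma> = (beta_c / \<beta>)\<^sup>2"
  shows "\<exists>c C :: real. c > 0 \<and> C > 0 \<and>
    (\<forall>x\<ge>0. measure M {\<omega> \<in> space M. deriv_mart_limit G \<beta> \<omega> < - x} \<ge> C * exp (- c * x powr \<gamma>))"
proof -
  interpret prob_space M by fact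
  interpret gaussian_tree M G
    by unfold_locales fact+
  obtain \<kappa> where \<kappa>: "0 < \<kappa>" "\<And>N. exp (- \<kappa> * 2 ^ N) \<le> prob (forced \<beta> N)"
    using prob_forced_ge[OF assms(4,5)] by metis
  \<comment> \<open>The level \<open>x\<close> lies below the bound of
    \<open>deriv_mart_limit_forced\<close> as soon as
    \<open>a * x < exp (\<beta>\<^sup>2 N / 2)\<close>.\<close>
  define a where "a = 2 * exp (4 * \<beta>)"
  have a: "0 < a"
    by (simp add: a_def)
  have \<gamma>: "\<gamma> = 2 * ln 2 / \<beta>\<^sup>2"
    by (simp add: assms(6) beta_c_def power_divide)
  have [measurable]: "deriv_mart_limit G \<beta> \<in> borel_measurable M"
    unfolding deriv_mart_limit_def deriv_mart_eq_tilted_sum by measurable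
  have "exp (- 2 * \<kappa>) * exp (- (2 * \<kappa> * a powr \<gamma>) * x powr \<gamma>) \<le>
      prob {\<omega> \<in> space M. deriv_mart_limit G \<beta> \<omega> < - x}" if x: "0 \<le> x" for x
  proof -
    \<comment> \<open>The maximum with 1 makes \<open>t\<close> nonnegative. \<open>N\<close> is the
      least integer strictly above \<open>t\<close>, where
      \<open>exp (\<beta>\<^sup>2 t / 2) = y\<close>; rounding up costs at most a factor 2 in
      \<open>2 ^ N\<close>.\<close>
    define y where "y = max (a * x) 1"
    define t where "t = 2 / \<beta>\<^sup>2 * ln y"
    define N where "N = Suc (nat \<lfloor>t\<rfloor>)"
    have y: "1 \<le> y" "a * x \<le> y"
      by (auto simp: y_def)
    have "0 \<le> t"
      using y by (simp add: t_def)
    then have N: "t < real N" "real N \<le> t + 1"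
      unfolding N_def by linarith+
    have "2 ^ N = exp (real N * ln 2)"
      by (simp add: exp_of_nat_mult)
    also have "\<dots> \<le> exp ((t + 1) * ln 2)"
      using N by simp
    also have "\<dots> = 2 * y powr \<gamma>"
    proof -
      have "(t + 1) * ln 2 = \<gamma> * ln y + ln 2"
        by (simp add: t_def \<gamma> algebra_simps)
      then show ?thesis
        using y by (simp add: exp_add powr_def)
    qed
    \<comment> \<open>The summand 1 covers small \<open>x\<close> and ends up in the constant
      \<open>C = exp (- 2 * \<kappa>)\<close>.\<close>
    also have "y powr \<gamma> \<le> a powr \<gamma> * x powr \<gamma> + 1"
      using a x by (auto simp: y_def max_def powr_mult)
    finally have pow: "2 ^ N \<le> 2 * (a powr \<gamma> * x powr \<gamma> + 1)"
      by simp
    have "ln y < \<beta>\<^sup>2 / 2 * real N"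
      using N(1) assms(4) by (simp add: t_def field_simps)
    then have "y < exp (\<beta>\<^sup>2 / 2 * real N)"
      using y by (metis exp_less_cancel_iff exp_ln less_le_trans zero_less_one)
    then have "a * x < exp (\<beta>\<^sup>2 / 2 * real N)"
      using y by linarith
    then have "x < exp (\<beta>\<^sup>2 / 2 * real N) / a"
      using a by (simp add: pos_less_divide_eq mult.commute)
    also have "\<dots> = 1 / 2 * exp (\<beta>\<^sup>2 / 2 * real N - 4 * \<beta>)"
      unfolding a_def exp_diff by simp
    finally have lt: "x < 1 / 2 * exp (\<beta>\<^sup>2 / 2 * real N - 4 * \<beta>)" .
    have "exp (- 2 * \<kappa>) * exp (- (2 * \<kappa> * a powr \<gamma>) * x powr \<gamma>) =
        exp (- \<kappa> * (2 * (a powr \<gamma> * x powr \<gamma> + 1)))"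
      unfolding exp_add[symmetric] by (simp add: algebra_simps)
    also have "\<dots> \<le> exp (- \<kappa> * 2 ^ N)"
      using pow \<kappa>(1) by simp
    also have "\<dots> \<le> prob (forced \<beta> N)"
      by (rule \<kappa>)
    also have "\<dots> \<le> prob {\<omega> \<in> space M. deriv_mart_limit G \<beta> \<omega> < - x}"
    proof (rule finite_measure_mono)
      show "forced \<beta> N \<subseteq> {\<omega> \<in> space M. deriv_mart_limit G \<beta> \<omega> < - x}"
      proof
        fix \<omega> assume \<omega>: "\<omega> \<in> forced \<beta> N"
        have "deriv_mart_limit G \<beta> \<omega> \<le> - (1 / 2) * exp (\<beta>\<^sup>2 / 2 * real N - 4 * \<beta>)"
          using assms(4) \<omega> by (intro deriv_mart_limit_forced) (auto simp: N_def)
        with lt \<omega> show "\<omega> \<in> {\<omega> \<in> space M. deriv_mart_limit G \<beta> \<omega> < - x}"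
          by (auto simp: forced_def)
      qed
    qed measurable
    finally show ?thesis .
  qed
  then show ?thesis
    using \<kappa>(1) a by (intro exI[of _ "2 * \<kappa> * a powr \<gamma>"] exI[of _ "exp (- 2 * \<kappa>)"]) auto
qed

end
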